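(* Let $A\in\mathbb{R}^{m\times n}$ have rank $n$ and let $b\in\mathbb{R}^m$. Let $\beta>0$ and let $\{W_k\}_{k\ge1}$ be a sequence of i.i.d. $m\times\ell$ random matrices with $\mathbb{E}(W_kW_k^\top)=\beta I_m$. Let $H_k=(W_k^\top A)^\dagger W_k^\top$ and assume that $C=\mathbb{E}(H_k^\top H_k)$ is defined and finite. Let $\{\alpha_k\}_{k\ge1}$ be a positive sequence of (deterministic) scalars such that $$\sum_{k=1}^\infty\alpha_k=\infty\qquad\text{and}\qquad\sum_{k=1}^\infty\alpha_k^2<\infty.$$ Set $P=\mathbb{E}\,H_k$ and $\widetilde{x}=(PA)^{-1}Pb$, and let $x_0\in\mathbb{R}^n$ be an arbitrary initial vector. For $k\ge1$ define $$x_k=x_{k-1}+\alpha_k s_k,\qquad s_k=-H_k(Ax_{k-1}-b).$$ Then: (i) The matrices $C$ and $A^\top CA$ are symmetric positive semi-definite, and $PA$ is symmetric positive definite (so that $\widetilde{x}$ is well defined). (ii) If $e_k=\|x_k-\widetilde{x}\|^2$, then $\mathbb{E}\,e_k<\infty$ and $\mathbb{E}(\|s_k\|^2)<\infty$ for all $k$. (iii) $x_k\to\widetilde{x}$ almost surely as $k\to\infty$.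
   Context: All random objects live on a common probability space. $\|\cdot\|$ denotes the Euclidean norm; $I_m$ is the $m\times m$ identity matrix; $M^\dagger$ denotes the Moore-Penrose pseudoinverse of a matrix $M$. Thus $H_k$ is a random $n\times m$ matrix, and since the $W_k$ are i.i.d., $C$ (an $m\times m$ matrix) and $P$ (an $n\times m$ matrix) do not depend on $k$. The initial vector $x_0$ is deterministic. *)

theory Defs
  imports "HOL-Probability.Probability"
begin

text \<open>The Moore--Penrose pseudoinverse, characterized by the four Penrose equations;
the lemma \<open>is_pinv_pinv\<close> below shows that the description operator in \<open>pinv\<close> is
always well defined.\<close>

definition is_pinv :: "real^'n^'m \<Rightarrow> real^'m^'n \<Rightarrow> bool" where
  "is_pinv M X \<longleftrightarrow> M ** X ** M = M \<and> X ** M ** X = X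
     \<and> transpose (M ** X) = M ** X \<and> transpose (X ** M) = X ** M"

definition pinv :: "real^'n^'m \<Rightarrow> real^'m^'n" where
  "pinv M = (THE X. is_pinv M X)"

definition sym_pos_semidef :: "real^'n^'n \<Rightarrow> bool" where
  "sym_pos_semidef M \<longleftrightarrow> transpose M = M \<and> (\<forall>v. 0 \<le> v \<bullet> (M *v v))"

definition sym_pos_def :: "real^'n^'n \<Rightarrow> bool" where
  "sym_pos_def M \<longleftrightarrow> transpose M = M \<and> (\<forall>v. v \<noteq> 0 \<longrightarrow> 0 < v \<bullet> (M *v v))"

lemma inner_transpose_mult: "x \<bullet> (transpose M *v y) = (M *v x) \<bullet> y"
  for M :: "real^'n^'m"
  by (metis dot_lmul_matrix inner_commute vector_transpose_matrix transpose_transpose)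

lemma symmetricI:
  fixes N :: "real^'n^'n"
  assumes "\<And>x y. (N *v x) \<bullet> y = x \<bullet> (N *v y)"
  shows "transpose N = N"
proof -
  have "x \<bullet> (transpose N *v y - N *v y) = 0" for x y
    by (simp add: inner_diff_right inner_transpose_mult assms del: transpose_matrix_vector)
  then have "transpose N *v y = N *v y" for y
    by (metis eq_iff_diff_eq_0 inner_eq_zero_iff)
  then show ?thesis by (simp add: matrix_eq)
qed

lemma is_pinv_unique:
  assumes "is_pinv M X" "is_pinv M Y"
  shows "X = Y"
proof -
  have X: "M ** X ** M = M" "X ** M ** X = X" "transpose (M ** X) = M ** X" "transpose (X ** M) = X ** M"
    and Y: "M ** Y ** M = M" "Y ** M ** Y = Y" "transpose (M ** Y) = M ** Y" "transpose (Y ** M) = Y ** M"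
    using assms by (auto simp: is_pinv_def)
  have "M ** X = transpose ((M ** Y) ** (M ** X))"
    using X Y by (simp add: matrix_mul_assoc)
  also have "\<dots> = (M ** X) ** (M ** Y)"
    unfolding matrix_transpose_mul[of "M ** Y"] using X Y by simp
  finally have 1: "M ** X = M ** Y"
    using X Y by (simp add: matrix_mul_assoc)
  have "X ** M = transpose ((X ** M) ** (Y ** M))"
    using X Y by (metis matrix_mul_assoc)
  also have "\<dots> = (Y ** M) ** (X ** M)"
    unfolding matrix_transpose_mul[of "X ** M"] using X Y by simp
  also have "\<dots> = Y ** M"
    using X by (metis matrix_mul_assoc)
  finally have 2: "X ** M = Y ** M" .
  have "X = X ** (M ** X)" using X by (simp add: matrix_mul_assoc)
  also have "\<dots> = Y ** M ** Y" by (simp only: 1 2 matrix_mul_assoc)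
  finally show ?thesis using Y by simp
qed

lemma ex_is_pinv: "\<exists>X. is_pinv M X"
  for M :: "real^'n^'m"
proof -
  let ?S = "range (\<lambda>w. transpose M *v w)"
  let ?T = "range (\<lambda>u. M *v u)"
  have subS: "subspace ?S" and subT: "subspace ?T"
    by (intro linear_subspace_image matrix_vector_mul_linear subspace_UNIV)+
  have ker: "r = 0" if r: "r \<in> ?S" and 0: "M *v r = 0" for r
  proof -
    obtain w where "r = transpose M *v w" using r by auto
    then have "r \<bullet> r = 0"
      using inner_transpose_mult[of r M w] 0 by simp
    then show ?thesis by simp
  qed
  have "\<exists>v. v \<in> ?S \<and> (\<forall>u. (M *v v - y) \<bullet> (M *v u) = 0)" for y
  proof -
    obtain a z where a: "a \<in> span ?T" and z: "\<And>w. w \<in> span ?T \<Longrightarrow> orthogonal z w"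
      and y: "y = a + z"
      using orthogonal_subspace_decomp_exists[of ?T y] by blast
    have "a \<in> ?T" using a subT by (metis span_eq_iff)
    then obtain u where u: "a = M *v u" by auto
    obtain r k where r: "r \<in> span ?S" and k: "\<And>w. w \<in> span ?S \<Longrightarrow> orthogonal k w"
      and urk: "u = r + k"
      using orthogonal_subspace_decomp_exists[of ?S u] by blast
    have "k \<bullet> (transpose M *v (M *v k)) = 0"
      by (rule k[OF span_base[OF rangeI], unfolded orthogonal_def])
    then have "M *v k = 0" by (simp add: inner_transpose_mult del: transpose_matrix_vector)
    then have "M *v r = a" by (simp add: u urk matrix_vector_right_distrib)
    moreover have "z \<bullet> (M *v u) = 0" for u
      using z[of "M *v u"] by (auto simp: orthogonal_def span_base)
    moreover have "r \<in> ?S" using r subS by (metis span_eq_iff)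
    ultimately show ?thesis
      by (intro exI[of _ r]) (auto simp: y)
  qed
  then obtain g where gS: "\<And>y. g y \<in> ?S"
    and g0: "\<And>y u. (M *v g y - y) \<bullet> (M *v u) = 0" by metis
  have g_eq: "g y = v" if v: "v \<in> ?S" and 0: "\<And>u. (M *v v - y) \<bullet> (M *v u) = 0" for y v
  proof -
    have "M *v (g y - v) = (M *v g y - y) - (M *v v - y)"
      by (simp add: matrix_vector_mult_diff_distrib)
    then have "(M *v (g y - v)) \<bullet> (M *v (g y - v)) = 0"
      by (metis 0 g0 inner_diff_left diff_zero)
    then have "g y - v = 0"
      using ker[of "g y - v"] subspace_diff[OF subS gS v] by simp
    then show ?thesis by simp
  qed
  have "linear g"
  proof (rule linearI)
    show "g (x + y) = g x + g y" for x y
    proof (rule g_eq)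
      show "g x + g y \<in> ?S" by (rule subspace_add[OF subS gS gS])
      show "(M *v (g x + g y) - (x + y)) \<bullet> (M *v u) = 0" for u
        using g0[of x u] g0[of y u] by (simp add: matrix_vector_right_distrib algebra_simps)
    qed
    show "g (c *\<^sub>R x) = c *\<^sub>R g x" for c x
    proof (rule g_eq)
      show "c *\<^sub>R g x \<in> ?S" by (rule subspace_scale[OF subS gS])
      show "(M *v (c *\<^sub>R g x) - c *\<^sub>R x) \<bullet> (M *v u) = 0" for u
        using g0[of x u] by (simp add: matrix_vector_mult_scaleR flip: scaleR_diff_right)
    qed
  qed
  then have mg: "matrix g *v y = g y" for y by (metis matrix_vector_mul)
  have MgM: "M *v g (M *v u) = M *v u" for u
  proof -
    have "(M *v g (M *v u) - M *v u) \<bullet> (M *v (g (M *v u) - u)) = 0" by (rule g0)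
    then show ?thesis by (simp add: matrix_vector_mult_diff_distrib)
  qed
  have gMg: "g (M *v g y) = g y" for y
    using gS by (intro g_eq) auto
  have symQ: "(M *v g x) \<bullet> y = x \<bullet> (M *v g y)" for x y
    using g0[of x "g y"] g0[of y "g x"]
    by (simp add: inner_diff_left) (simp add: inner_commute)
  have symP: "g (M *v x) \<bullet> y = x \<bullet> g (M *v y)" for x y
  proof -
    have *: "g (M *v x) \<bullet> y = g (M *v x) \<bullet> g (M *v y)" for x y
    proof -
      obtain z where "g (M *v x) = transpose M *v z" using gS[of "M *v x"] by auto
      then show ?thesis
        by (metis MgM inner_commute inner_transpose_mult)
    qed
    show ?thesis using *[of x y] *[of y x] by (simp add: inner_commute)
  qed
  have "is_pinv M (matrix g)"
    unfolding is_pinv_def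
  proof (intro conjI)
    show "M ** matrix g ** M = M" "matrix g ** M ** matrix g = matrix g"
      by (simp_all add: matrix_eq mg MgM gMg flip: matrix_vector_mul_assoc)
    show "transpose (M ** matrix g) = M ** matrix g" "transpose (matrix g ** M) = matrix g ** M"
      by (rule symmetricI; simp add: mg symP symQ flip: matrix_vector_mul_assoc)+
  qed
  then show ?thesis ..
qed

lemma is_pinv_pinv: "is_pinv M (pinv M)"
  unfolding pinv_def by (metis ex_is_pinv is_pinv_unique theI)

end

theory Submission
  imports Defs
begin

text \<open>Write \<open>P = E H\<close>. The iteration is a stochastic approximation scheme for the equation
\<open>P (A x - b) = 0\<close>, and it converges for two reasons.

The mean field is a contraction towards \<open>xt\<close>. Each \<open>H\<^sub>k A = (W\<^sub>k\<^sup>T A)\<^sup>\<dagger> W\<^sub>k\<^sup>T A\<close> is an orthogonal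
projection, so its mean \<open>PA\<close> is symmetric and positive semi-definite. Isotropy of the second moment
of \<open>W\<close> and injectivity of \<open>A\<close> exclude a common kernel
(\<open>sym_pos_def_expected_projection\<close>). Hence \<open>PA\<close> is positive definite, \<open>xt\<close> is the unique root,
and \<open>v \<bullet> PA v \<ge> l |v|\<^sup>2\<close> for some \<open>l > 0\<close>.

The noise is square summable. The existence of \<open>C\<close> makes \<open>E |H|\<^sup>2\<close> finite, and \<open>H\<^sub>k\<^sub>+\<^sub>1\<close> is
independent of \<open>x\<^sub>k\<close>. With \<open>e\<^sub>k = |x\<^sub>k - xt|\<^sup>2\<close> and conditional expectation on the first \<open>k\<close> sketches,
this gives (\<open>expected_squared_distance_after_step\<close>)
\<open>E (e\<^sub>k\<^sub>+\<^sub>1 | past) \<le> (1 - 2 l \<alpha>\<^sub>k\<^sub>+\<^sub>1 + c \<alpha>\<^sub>k\<^sub>+\<^sub>1\<^sup>2) e\<^sub>k + c \<alpha>\<^sub>k\<^sub>+\<^sub>1\<^sup>2\<close>.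
Independence of the \<open>H\<^sub>k\<close> requires them to be measurable functions of the \<open>W\<^sub>k\<close>. The pseudoinverse
is not continuous, but its graph is closed, and that suffices
(\<open>borel_measurable_closed_graph\<close>).

Almost sure convergence follows without the martingale convergence theorem
(\<open>perturbed_contraction_tendsto_zero\<close>). Adding to \<open>e\<^sub>k\<close> a tail of \<open>c \<Sum> \<alpha>\<^sup>2\<close> gives, for late
indices, a nonnegative supermartingale. Its expectation has lower limit \<open>0\<close> because the
\<open>\<alpha>\<^sub>k\<close> have infinite sum, and the maximal inequality turns this into almost sure convergence to \<open>0\<close>.\<close>

section \<open>Borel measurability of the pseudoinverse\<close>

text \<open>The preimage of a compact set is closed: it is the projection of a closed subset of the graph
along a compact factor. A closed set is a countable union of compact sets, so its preimage is an
\<open>F\<^sub>\<sigma>\<close>. The function itself may well be discontinuous.\<close>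

lemma borel_measurable_closed_graph:
  fixes f :: "'a::euclidean_space \<Rightarrow> 'b::euclidean_space"
  assumes cl: "closed {(x, y). y = f x}"
  shows "f \<in> borel_measurable borel"
proof -
  have bounded_case: "closed (f -` K)" if K: "compact K" for K
    unfolding closed_sequential_limits
  proof (intro allI impI)
    fix u l assume "(\<forall>n::nat. u n \<in> f -` K) \<and> u \<longlonglongrightarrow> l"
    then have u: "\<forall>n. f (u n) \<in> K" and ul: "u \<longlonglongrightarrow> l" by auto
    from K obtain y r where y: "y \<in> K" and r: "strict_mono r" and lim: "((f \<circ> u) \<circ> r) \<longlonglongrightarrow> y"
      using u unfolding compact_def by (metis comp_apply)
    have "(\<lambda>n. (u (r n), f (u (r n)))) \<longlonglongrightarrow> (l, y)"
      using LIMSEQ_subseq_LIMSEQ[OF ul r] lim by (intro tendsto_Pair) (simp_all add: comp_def)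
    then have "(l, y) \<in> {(x, y). y = f x}"
      by (rule closed_sequentially[OF cl, rotated]) auto
    then show "l \<in> f -` K" using y by auto
  qed
  show ?thesis
    unfolding borel_eq_closed
  proof (rule measurable_sigma_sets)
    fix S :: "'b set" assume "S \<in> Collect closed"
    then have "closed S" by simp
    have "f -` S = (\<Union>n::nat. f -` (S \<inter> cball 0 (real n)))"
      by (auto simp: real_arch_simple)
    moreover have "closed (f -` (S \<inter> cball 0 (real n)))" for n :: nat
      by (rule bounded_case) (simp add: closed_Int_compact \<open>closed S\<close>)
    ultimately have "f -` S \<in> sets borel"
      by (simp only:) (intro sets.countable_nat_UN image_subsetI borel_closed)
    then show "f -` S \<inter> space (sigma UNIV (Collect closed)) \<in> sets (sigma UNIV (Collect closed))"
      unfolding borel_eq_closed[symmetric] by simp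
  qed auto
qed

lemma continuous_on_matrix_mult [continuous_intros]:
  fixes f :: "'a::topological_space \<Rightarrow> real^'n^'m" and g :: "'a \<Rightarrow> real^'k^'n"
  assumes "continuous_on S f" "continuous_on S g"
  shows "continuous_on S (\<lambda>x. f x ** g x)"
  unfolding matrix_matrix_mult_def by (intro continuous_intros assms)

lemma continuous_on_transpose [continuous_intros]:
  fixes f :: "'a::topological_space \<Rightarrow> real^'n^'m"
  assumes "continuous_on S f"
  shows "continuous_on S (\<lambda>x. transpose (f x))"
  unfolding transpose_def by (intro continuous_intros assms)

lemma continuous_on_matrix_vector_mult [continuous_intros]:
  fixes f :: "'a::topological_space \<Rightarrow> real^'n^'m" and g :: "'a \<Rightarrow> real^'n"
  assumes "continuous_on S f" "continuous_on S g"
  shows "continuous_on S (\<lambda>x. f x *v g x)"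
  unfolding matrix_vector_mult_def by (intro continuous_intros assms)

text \<open>The pseudoinverse jumps wherever the rank drops, so continuity is not available. But the four
Penrose equations are closed conditions on the pair of matrices, and they determine the
pseudoinverse; hence its graph is closed.\<close>

lemma borel_measurable_pinv: "(pinv :: real^'n^'m \<Rightarrow> _) \<in> borel_measurable borel"
proof (rule borel_measurable_closed_graph)
  have "{(M, X). X = pinv M} = {(M :: real^'n^'m, X). is_pinv M X}"
    using is_pinv_pinv is_pinv_unique by blast
  also have "closed \<dots>"
    unfolding is_pinv_def case_prod_unfold
    by (intro closed_Collect_conj closed_Collect_eq continuous_intros)
  finally show "closed {(M :: real^'n^'m, X). X = pinv M}" .
qed

lemma borel_measurable_sketched_pinv:
  fixes A :: "real^'n^'m"
  shows "(\<lambda>W :: real^'l^'m. pinv (transpose W ** A) ** transpose W) \<in> borel_measurable borel"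
proof -
  have "(\<lambda>W :: real^'l^'m. (pinv (transpose W ** A), transpose W)) \<in> borel_measurable borel"
    by (intro borel_measurable_Pair measurable_compose[OF _ borel_measurable_pinv]
        borel_measurable_continuous_onI continuous_intros)
  moreover have "(\<lambda>p :: (real^'l^'n) \<times> (real^'m^'l). fst p ** snd p) \<in> borel_measurable borel"
    by (intro borel_measurable_continuous_onI continuous_intros)
  ultimately have "(\<lambda>W :: real^'l^'m. fst (pinv (transpose W ** A), transpose W)
      ** snd (pinv (transpose W ** A), transpose W)) \<in> borel_measurable borel"
    by (rule measurable_compose)
  then show ?thesis by (simp only: fst_conv snd_conv)
qed

lemma borel_measurable_matrix_vector_mult:
  fixes X :: "'a \<Rightarrow> real^'n^'m" and y :: "'a \<Rightarrow> real^'n"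
  assumes "X \<in> borel_measurable N" "y \<in> borel_measurable N"
  shows "(\<lambda>\<omega>. X \<omega> *v y \<omega>) \<in> borel_measurable N"
proof -
  have "(\<lambda>p :: (real^'n^'m) \<times> (real^'n). fst p *v snd p) \<in> borel_measurable borel"
    by (intro borel_measurable_continuous_onI continuous_intros)
  from measurable_compose[OF borel_measurable_Pair[OF assms] this] show ?thesis by simp
qed

lemma borel_measurable_vec_nth:
  fixes f :: "'a \<Rightarrow> real^'n"
  assumes "f \<in> borel_measurable N"
  shows "(\<lambda>\<omega>. f \<omega> $ i) \<in> borel_measurable N"
  by (rule borel_measurable_continuous_on[OF _ assms]) (intro continuous_intros)

section \<open>Matrix algebra\<close>

lemma norm_matrix_vector_mult_le:
  fixes X :: "real^'n^'m"
  shows "norm (X *v y) \<le> norm X * norm y"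
proof -
  have "\<bar>(X *v y) $ i\<bar> \<le> norm (X $ i) * norm y" for i
    using Cauchy_Schwarz_ineq2[of "X $ i" y] by (simp add: matrix_mult_dot)
  then have "norm (X *v y) \<le> L2_set (\<lambda>i. norm (X $ i) * norm y) UNIV"
    unfolding norm_vec_def[of "X *v y"] by (intro L2_set_mono) simp_all
  also have "\<dots> = norm X * norm y"
    by (simp add: norm_vec_def[of X] L2_set_left_distrib)
  finally show ?thesis .
qed

text \<open>The norm on the type of matrices is the Frobenius norm. This identity is how the second moment of
\<open>H\<close> is read off from the existence of \<open>C\<close>.\<close>

lemma norm_matrix_power2_eq_trace:
  fixes X :: "real^'n^'m"
  shows "(norm X)\<^sup>2 = trace (transpose X ** X)"
proof -
  have "(norm X)\<^sup>2 = (\<Sum>i\<in>UNIV. \<Sum>j\<in>UNIV. X $ i $ j * X $ i $ j)"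
    by (simp add: power2_norm_eq_inner inner_vec_def)
  also have "\<dots> = trace (transpose X ** X)"
    unfolding trace_def transpose_def matrix_matrix_mult_def by (subst sum.swap) simp
  finally show ?thesis .
qed

lemma bounded_linear_matrix_bilinear_form:
  fixes u :: "real^'m" and v :: "real^'n"
  shows "bounded_linear (\<lambda>X. u \<bullet> (X *v v))"
  unfolding linear_conv_bounded_linear[symmetric]
  by (rule linearI)
    (simp_all add: matrix_vector_mult_add_rdistrib inner_add_right scaleR_matrix_vector_assoc[symmetric])

lemma bounded_linear_matrix_mult_right:
  fixes A :: "real^'n^'m"
  shows "bounded_linear (\<lambda>X :: real^'m^'k. X ** A)"
  unfolding linear_conv_bounded_linear[symmetric]
  by (rule linearI) (simp_all add: vec_eq_iff matrix_matrix_mult_def distrib_right sum.distrib sum_distrib_left mult.assoc)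

lemma bounded_linear_transpose: "bounded_linear (transpose :: real^'n^'m \<Rightarrow> _)"
  unfolding linear_conv_bounded_linear[symmetric]
  by (rule linearI) (simp_all add: transpose_def vec_eq_iff)

lemma bounded_linear_trace: "bounded_linear (trace :: real^'n^'n \<Rightarrow> real)"
  unfolding linear_conv_bounded_linear[symmetric]
  by (rule linearI) (simp_all add: trace_def sum.distrib sum_distrib_left)

text \<open>\<open>Q\<close> is the orthogonal projection onto the row space of \<open>W\<^sup>T A\<close>. This gives the symmetry and
positivity of \<open>PA\<close>, and the third equation says that the kernel of \<open>Q\<close> is that of \<open>W\<^sup>T A\<close>.\<close>

lemma sketched_pinv_projection:
  fixes A :: "real^'n^'m" and W :: "real^'l^'m"
  defines "Q \<equiv> pinv (transpose W ** A) ** transpose W ** A"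
  shows "transpose Q = Q"
    and "Q ** Q = Q"
    and "transpose W ** A ** Q = transpose W ** A"
  using is_pinv_pinv[of "transpose W ** A"]
  unfolding is_pinv_def Q_def by (simp_all add: matrix_mul_assoc)

lemma sym_pos_def_imp_invertible:
  fixes G :: "real^'n^'n"
  assumes "sym_pos_def G"
  shows "invertible G"
proof -
  have "v = 0" if "G *v v = 0" for v
    using assms that unfolding sym_pos_def_def by (metis inner_zero_right less_irrefl)
  then show ?thesis
    by (metis invertible_def invertible_left_inverse matrix_left_invertible_ker)
qed

text \<open>The quadratic form is homogeneous of degree two and attains a positive minimum on the unit sphere.\<close>

lemma sym_pos_def_coercive:
  fixes G :: "real^'n^'n"
  assumes "sym_pos_def G"
  obtains l where "l > 0" "\<And>v. l * (norm v)\<^sup>2 \<le> v \<bullet> (G *v v)"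
proof -
  have "continuous_on (sphere 0 1) (\<lambda>v. v \<bullet> (G *v v))"
    by (rule continuous_on_inner[OF continuous_on_id matrix_vector_mult_linear_continuous_on])
  moreover have "sphere (0 :: real^'n) 1 \<noteq> {}"
    using vector_choose_size[of 1] by fastforce
  ultimately have "\<exists>u\<in>sphere (0 :: real^'n) 1. \<forall>v\<in>sphere 0 1. u \<bullet> (G *v u) \<le> v \<bullet> (G *v v)"
    by (intro continuous_attains_inf compact_sphere)
  then obtain u where u: "u \<in> sphere (0 :: real^'n) 1"
    and min: "\<And>v. v \<in> sphere 0 1 \<Longrightarrow> u \<bullet> (G *v u) \<le> v \<bullet> (G *v v)"
    by blast
  have pos: "u \<bullet> (G *v u) > 0"
    using assms u unfolding sym_pos_def_def by (metis dist_0_norm mem_sphere norm_zero zero_neq_one)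
  have "u \<bullet> (G *v u) * (norm v)\<^sup>2 \<le> v \<bullet> (G *v v)" for v
  proof (cases "v = 0")
    case False
    have v: "v = norm v *\<^sub>R sgn v" using False by (simp add: sgn_div_norm)
    have "v \<bullet> (G *v v) = (norm v)\<^sup>2 * (sgn v \<bullet> (G *v sgn v))"
      using arg_cong[OF v, of "\<lambda>v. v \<bullet> (G *v v)"]
      by (simp only: matrix_vector_mult_scaleR) (simp add: power2_eq_square)
    moreover have "u \<bullet> (G *v u) \<le> sgn v \<bullet> (G *v sgn v)"
      by (rule min) (simp add: norm_sgn False)
    then have "(norm v)\<^sup>2 * (u \<bullet> (G *v u)) \<le> (norm v)\<^sup>2 * (sgn v \<bullet> (G *v sgn v))"
      by (intro mult_left_mono) simp_all
    ultimately show ?thesis by (simp only: mult.commute)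
  qed simp
  with pos show ?thesis by (rule that)
qed

section \<open>Nonnegative supermartingales with vanishing expectation\<close>

text \<open>The supermartingale property is expressed by integrals over events of the past, which avoids
conditional expectations. The proof is optional stopping at the first time that \<open>V\<close> reaches
\<open>\<epsilon>\<close>: by induction on \<open>d\<close>, the expectation of \<open>V n\<close> dominates \<open>\<epsilon>\<close> times the probability that
this has happened, plus the integral of the current value over the event that it has not.\<close>

lemma (in prob_space) supermartingale_maximal_inequality:
  fixes V :: "nat \<Rightarrow> 'a \<Rightarrow> real"
  assumes sub: "\<And>k. subalgebra M (F k)"
    and F_mono: "\<And>j k. j \<le> k \<Longrightarrow> sets (F j) \<subseteq> sets (F k)"
    and adapted: "\<And>k. V k \<in> borel_measurable (F k)"
    and int: "\<And>k. integrable M (V k)"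
    and nonneg: "\<And>k \<omega>. 0 \<le> V k \<omega>"
    and super: "\<And>k B. n \<le> k \<Longrightarrow> B \<in> sets (F k) \<Longrightarrow>
      (\<integral>\<omega>. indicator B \<omega> * V (Suc k) \<omega> \<partial>M) \<le> (\<integral>\<omega>. indicator B \<omega> * V k \<omega> \<partial>M)"
  shows "\<epsilon> * prob {\<omega>\<in>space M. \<exists>k\<in>{n..n+d}. \<epsilon> \<le> V k \<omega>} \<le> expectation (V n)"
proof -
  define hit where "hit d = {\<omega>\<in>space M. \<exists>k\<in>{n..n+d}. \<epsilon> \<le> V k \<omega>}" for d
  define low where "low d = {\<omega>\<in>space M. \<forall>k\<in>{n..n+d}. V k \<omega> < \<epsilon>}" for d
  have VM [measurable]: "V k \<in> borel_measurable M" for k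
    using int by auto
  have [measurable]: "hit d \<in> sets M" "low d \<in> sets M" for d
    unfolding hit_def low_def by measurable
  have low_F: "low d \<in> sets (F (n+d))" for d
  proof -
    have sp: "space (F k) = space M" for k
      using sub by (simp add: subalgebra_def)
    have V: "V k \<in> borel_measurable (F (n+d))" if "k \<in> {n..n+d}" for k
      using adapted[of k] F_mono[of k "n+d"] that sp
      by (auto simp: measurable_def)
    have "{\<omega>\<in>space (F (n+d)). \<forall>k\<in>{n..n+d}. V k \<omega> < \<epsilon>} \<in> sets (F (n+d))"
      by (rule sets.sets_Collect_finite_All') (use V in \<open>auto intro!: borel_measurable_less\<close>)
    then show ?thesis by (simp add: low_def sp)
  qed
  have int_low: "integrable M (\<lambda>\<omega>. indicator (low d) \<omega> * V k \<omega>)" for d k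
    using integrable_mult_indicator[OF _ int[of k], of "low d"] by simp
  have int_hit: "integrable M (\<lambda>\<omega>. \<epsilon> * indicator (hit d) \<omega>)" for d
    by (simp add: integrable_real_indicator less_top[symmetric])
  have split: "(\<integral>\<omega>. \<epsilon> * indicator (hit d) \<omega> + indicator (low d) \<omega> * V k \<omega> \<partial>M)
      = \<epsilon> * prob (hit d) + (\<integral>\<omega>. indicator (low d) \<omega> * V k \<omega> \<partial>M)" for d k
    using int_low int_hit by simp
  have "\<epsilon> * prob (hit d) + (\<integral>\<omega>. indicator (low d) \<omega> * V (n+d) \<omega> \<partial>M) \<le> expectation (V n)"
  proof (induction d)
    case 0
    have "(\<integral>\<omega>. \<epsilon> * indicator (hit 0) \<omega> + indicator (low 0) \<omega> * V n \<omega> \<partial>M) \<le> expectation (V n)"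
      by (intro integral_mono Bochner_Integration.integrable_add int_low int_hit int)
         (auto simp: hit_def low_def indicator_def nonneg)
    then show ?case using split[of 0 n] by simp
  next
    case (Suc d)
    have "(\<integral>\<omega>. \<epsilon> * indicator (hit (Suc d)) \<omega> + indicator (low (Suc d)) \<omega> * V (n + Suc d) \<omega> \<partial>M)
        \<le> (\<integral>\<omega>. \<epsilon> * indicator (hit d) \<omega> + indicator (low d) \<omega> * V (n + Suc d) \<omega> \<partial>M)"
    proof (intro integral_mono Bochner_Integration.integrable_add int_low int_hit)
      fix \<omega> assume w: "\<omega> \<in> space M"
      have "{n..n + Suc d} = insert (n + Suc d) {n..n+d}" by auto
      then show "\<epsilon> * indicator (hit (Suc d)) \<omega> + indicator (low (Suc d)) \<omega> * V (n + Suc d) \<omega>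
        \<le> \<epsilon> * indicator (hit d) \<omega> + indicator (low d) \<omega> * V (n + Suc d) \<omega>"
        using w by (auto simp: hit_def low_def indicator_def not_less not_le intro: less_imp_le)
    qed
    then have "\<epsilon> * prob (hit (Suc d)) + (\<integral>\<omega>. indicator (low (Suc d)) \<omega> * V (n + Suc d) \<omega> \<partial>M)
        \<le> \<epsilon> * prob (hit d) + (\<integral>\<omega>. indicator (low d) \<omega> * V (n + Suc d) \<omega> \<partial>M)"
      by (simp only: split)
    also have "\<dots> \<le> \<epsilon> * prob (hit d) + (\<integral>\<omega>. indicator (low d) \<omega> * V (n + d) \<omega> \<partial>M)"
      using super[OF _ low_F[of d]] by simp
    also note Suc.IH
    finally show ?case .
  qed
  moreover have "0 \<le> (\<integral>\<omega>. indicator (low d) \<omega> * V (n+d) \<omega> \<partial>M)"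
    by (intro Bochner_Integration.integral_nonneg) (simp add: nonneg)
  ultimately show ?thesis unfolding hit_def by linarith
qed

text \<open>By the maximal inequality, the event that \<open>V\<close> exceeds \<open>\<epsilon>\<close> infinitely often has probability at
most \<open>E (V n) / \<epsilon>\<close> for every late \<open>n\<close>. Arbitrarily small values of \<open>E (V n)\<close> therefore make it a
null event; the martingale convergence theorem is avoided because the limit is known to be \<open>0\<close>.\<close>

lemma (in prob_space) supermartingale_tendsto_zero:
  fixes V :: "nat \<Rightarrow> 'a \<Rightarrow> real"
  assumes sub: "\<And>k. subalgebra M (F k)"
    and F_mono: "\<And>j k. j \<le> k \<Longrightarrow> sets (F j) \<subseteq> sets (F k)"
    and adapted: "\<And>k. V k \<in> borel_measurable (F k)"
    and int: "\<And>k. integrable M (V k)"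
    and nonneg: "\<And>k \<omega>. 0 \<le> V k \<omega>"
    and super: "\<And>k B. K \<le> k \<Longrightarrow> B \<in> sets (F k) \<Longrightarrow>
      (\<integral>\<omega>. indicator B \<omega> * V (Suc k) \<omega> \<partial>M) \<le> (\<integral>\<omega>. indicator B \<omega> * V k \<omega> \<partial>M)"
    and small: "\<And>\<delta>. \<delta> > 0 \<Longrightarrow> \<exists>n\<ge>K. expectation (V n) < \<delta>"
  shows "AE \<omega> in M. (\<lambda>k. V k \<omega>) \<longlonglongrightarrow> 0"
proof -
  have [measurable]: "V k \<in> borel_measurable M" for k
    using int by auto
  have ev: "AE \<omega> in M. \<exists>n. \<forall>k\<ge>n. V k \<omega> < \<epsilon>" if \<epsilon>: "\<epsilon> > 0" for \<epsilon>
  proof -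
    define S where "S = {\<omega>\<in>space M. \<not> (\<exists>n. \<forall>k\<ge>n. V k \<omega> < \<epsilon>)}"
    have [measurable]: "S \<in> sets M" unfolding S_def by measurable
    have tail: "\<epsilon> * prob S \<le> expectation (V n)" if n: "n \<ge> K" for n
    proof -
      define hit where "hit d = {\<omega>\<in>space M. \<exists>k\<in>{n..n+d}. \<epsilon> \<le> V k \<omega>}" for d
      have [measurable]: "hit d \<in> sets M" for d unfolding hit_def by measurable
      have "(\<lambda>d. prob (hit d)) \<longlonglongrightarrow> prob (\<Union>d. hit d)"
      proof (rule finite_Lim_measure_incseq)
        show "incseq hit"
          unfolding incseq_def hit_def by fastforce
      qed auto
      then have "(\<lambda>d. \<epsilon> * prob (hit d)) \<longlonglongrightarrow> \<epsilon> * prob (\<Union>d. hit d)"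
        by (intro tendsto_intros)
      moreover have "\<epsilon> * prob (hit d) \<le> expectation (V n)" for d
        unfolding hit_def
        by (rule supermartingale_maximal_inequality[of F])
          (use sub F_mono adapted int nonneg super n in auto)
      ultimately have "\<epsilon> * prob (\<Union>d. hit d) \<le> expectation (V n)"
        by (intro LIMSEQ_le_const2) auto
      moreover have "S \<subseteq> (\<Union>d. hit d)"
      proof
        fix \<omega> assume "\<omega> \<in> S"
        then obtain k where "k \<ge> n" "\<epsilon> \<le> V k \<omega>" "\<omega> \<in> space M"
          unfolding S_def by (auto simp: not_less)
        then have "\<omega> \<in> hit (k - n)" unfolding hit_def by auto
        then show "\<omega> \<in> (\<Union>d. hit d)" by blast
      qed
      then have "prob S \<le> prob (\<Union>d. hit d)" by (intro finite_measure_mono) auto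
      ultimately show ?thesis using \<epsilon> by (meson mult_left_mono less_imp_le order_trans)
    qed
    have "prob S = 0"
    proof (rule ccontr)
      assume "prob S \<noteq> 0"
      then have "\<epsilon> * prob S > 0" using \<epsilon> by (simp add: zero_less_measure_iff)
      then show False using small tail by (metis not_less)
    qed
    then show ?thesis
      by (subst AE_iff_measurable[of S]) (auto simp: S_def emeasure_eq_measure)
  qed
  have "AE \<omega> in M. \<forall>j::nat. \<exists>n. \<forall>k\<ge>n. V k \<omega> < inverse (real (Suc j))"
    unfolding AE_all_countable by (intro allI ev) simp
  then show ?thesis
  proof (rule AE_mp, intro AE_I2 impI LIMSEQ_I)
    fix \<omega> and r :: real
    assume *: "\<forall>j::nat. \<exists>n. \<forall>k\<ge>n. V k \<omega> < inverse (real (Suc j))" and "0 < r"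
    from reals_Archimedean[OF \<open>0 < r\<close>] obtain j where "inverse (real (Suc j)) < r" by auto
    with * show "\<exists>no. \<forall>n\<ge>no. norm (V n \<omega> - 0) < r"
      using nonneg by (metis abs_of_nonneg diff_zero less_trans real_norm_def)
  qed
qed

text \<open>A variant of the Robbins--Siegmund theorem. Once \<open>c a\<^sub>k < l\<close>, the quadratic term is absorbed by half
of the contraction, so adding to \<open>e\<^sub>k\<close> the noise still to come, \<open>c (a\<^sub>k\<^sup>2 + a\<^sub>k\<^sub>+\<^sub>1\<^sup>2 + \<dots>)\<close>,
gives a nonnegative supermartingale. The other half makes the expectation of this
supermartingale fall by at least \<open>l a\<^sub>k E e\<^sub>k\<close> in step \<open>k\<close>. As \<open>\<Sum> a\<^sub>k = \<infinity>\<close>, the numbers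
\<open>E e\<^sub>k\<close> cannot stay away from \<open>0\<close>.\<close>

lemma (in prob_space) perturbed_contraction_tendsto_zero:
  fixes e :: "nat \<Rightarrow> 'a \<Rightarrow> real" and a :: "nat \<Rightarrow> real"
  assumes sub: "\<And>k. subalgebra M (F k)"
    and F_mono: "\<And>j k. j \<le> k \<Longrightarrow> sets (F j) \<subseteq> sets (F k)"
    and adapted: "\<And>k. e k \<in> borel_measurable (F k)"
    and int: "\<And>k. integrable M (e k)"
    and nonneg: "\<And>k \<omega>. 0 \<le> e k \<omega>"
    and l: "l > 0" and c: "c \<ge> 0"
    and a_pos: "\<And>k. a k > 0"
    and a_sum: "filterlim (\<lambda>N. \<Sum>k<N. a k) at_top sequentially"
    and a_sq: "summable (\<lambda>k. (a k)\<^sup>2)"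
    and step: "\<And>k B. B \<in> sets (F k) \<Longrightarrow>
      (\<integral>\<omega>. indicator B \<omega> * e (Suc k) \<omega> \<partial>M)
        \<le> (1 - 2 * l * a k + c * (a k)\<^sup>2) * (\<integral>\<omega>. indicator B \<omega> * e k \<omega> \<partial>M) + c * (a k)\<^sup>2 * prob B"
  shows "AE \<omega> in M. (\<lambda>k. e k \<omega>) \<longlonglongrightarrow> 0"
proof -
  define T where "T k = (\<Sum>j. (a (j + k))\<^sup>2)" for k
  have summ: "summable (\<lambda>j. (a (j + k))\<^sup>2)" for k
    using a_sq by (rule summable_ignore_initial_segment)
  have T_Suc: "T k = (a k)\<^sup>2 + T (Suc k)" for k
    unfolding T_def using suminf_split_head[OF summ[of k]] by simp
  have T_nonneg: "0 \<le> T k" for k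
    unfolding T_def by (intro suminf_nonneg summ) simp
  have T_lim: "T \<longlonglongrightarrow> 0"
    unfolding T_def by (rule suminf_exist_split2[OF a_sq])
  define V where "V k \<omega> = e k \<omega> + c * T k" for k \<omega>
  have int_B: "integrable M (\<lambda>\<omega>. indicator B \<omega> * e k \<omega>)" if "B \<in> sets M" for B k
    using integrable_mult_indicator[OF that int[of k]] by simp
  have V_B: "(\<integral>\<omega>. indicator B \<omega> * V k \<omega> \<partial>M) = (\<integral>\<omega>. indicator B \<omega> * e k \<omega> \<partial>M) + c * T k * prob B"
    if B: "B \<in> sets M" for B k
  proof -
    have "integrable M (\<lambda>\<omega>. indicator B \<omega> * (c * T k))"
      using B by (simp add: less_top[symmetric])
    then show ?thesis
      unfolding V_def distrib_left using int_B[OF B] B by simp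
  qed
  have "(\<lambda>k. sqrt ((a k)\<^sup>2)) \<longlonglongrightarrow> sqrt 0"
    by (intro tendsto_real_sqrt summable_LIMSEQ_zero[OF a_sq])
  then have "a \<longlonglongrightarrow> 0" using a_pos by (simp add: less_imp_le)
  then have "(\<lambda>k. c * a k) \<longlonglongrightarrow> c * 0" by (intro tendsto_intros)
  then have "eventually (\<lambda>k. c * a k < l) sequentially"
    using l by (intro order_tendstoD) auto
  then obtain K where K: "\<And>k. k \<ge> K \<Longrightarrow> c * a k < l"
    by (auto simp: eventually_sequentially)
  have decrease: "(\<integral>\<omega>. indicator B \<omega> * V (Suc k) \<omega> \<partial>M)
      \<le> (\<integral>\<omega>. indicator B \<omega> * V k \<omega> \<partial>M) - l * a k * (\<integral>\<omega>. indicator B \<omega> * e k \<omega> \<partial>M)"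
    if k: "K \<le> k" and B: "B \<in> sets (F k)" for k B
  proof -
    have BM: "B \<in> sets M" using B sub by (auto simp: subalgebra_def)
    have "c * a k * a k \<le> l * a k"
      using K[OF k] a_pos[of k] by (intro mult_right_mono) auto
    then have "1 - 2 * l * a k + c * (a k)\<^sup>2 \<le> 1 - l * a k"
      by (simp add: power2_eq_square mult.assoc)
    moreover have "0 \<le> (\<integral>\<omega>. indicator B \<omega> * e k \<omega> \<partial>M)"
      by (intro Bochner_Integration.integral_nonneg) (simp add: nonneg)
    ultimately have "(1 - 2 * l * a k + c * (a k)\<^sup>2) * (\<integral>\<omega>. indicator B \<omega> * e k \<omega> \<partial>M)
        \<le> (1 - l * a k) * (\<integral>\<omega>. indicator B \<omega> * e k \<omega> \<partial>M)"
      by (rule mult_right_mono)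
    with step[OF B] show ?thesis
      unfolding V_B[OF BM] T_Suc[of k] by (simp add: algebra_simps)
  qed
  have E_V: "expectation (V k) = expectation (e k) + c * T k" for k
    unfolding V_def using int by (simp add: prob_space)
  have E_dec: "expectation (V (Suc k)) \<le> expectation (V k) - l * a k * expectation (e k)" if "K \<le> k" for k
  proof -
    have "space M \<in> sets (F k)"
      using sub sets.top[of "F k"] by (simp add: subalgebra_def)
    from decrease[OF that this] show ?thesis
      by (simp cong: Bochner_Integration.integral_cong)
  qed
  \<comment> \<open>Otherwise the expected decrements \<open>l a\<^sub>k E e\<^sub>k\<close> would have a divergent sum.\<close>
  have small_e: "\<exists>n\<ge>N. expectation (e n) < \<delta>" if \<delta>: "\<delta> > 0" and N: "N \<ge> K" for \<delta> N
  proof (rule ccontr)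
    assume "\<not> ?thesis"
    then have large: "expectation (e n) \<ge> \<delta>" if "n \<ge> N" for n
      using that by (meson not_less)
    have "l * \<delta> * (\<Sum>k<N+d. a k) \<le> l * \<delta> * (\<Sum>k<N. a k) + expectation (V N) - expectation (V (N+d))" for d
    proof (induction d)
      case (Suc d)
      have "l * a (N+d) * \<delta> \<le> l * a (N+d) * expectation (e (N+d))"
        using large[of "N+d"] l a_pos[of "N+d"] by (intro mult_left_mono) auto
      with Suc E_dec[of "N+d"] N show ?case by (simp add: algebra_simps)
    qed simp
    moreover have "0 \<le> expectation (V k)" for k
      by (intro Bochner_Integration.integral_nonneg) (simp add: V_def nonneg c T_nonneg)
    ultimately have bdd: "l * \<delta> * (\<Sum>k<N+d. a k) \<le> l * \<delta> * (\<Sum>k<N. a k) + expectation (V N)" for d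
      by (smt (verit))
    define R where "R = (\<Sum>k<N. a k) + expectation (V N) / (l * \<delta>)"
    have "(\<Sum>k<N+d. a k) \<le> R" for d
      using bdd[of d] l \<delta> unfolding R_def by (simp add: field_simps)
    moreover from a_sum have "eventually (\<lambda>n. R < (\<Sum>k<n. a k)) sequentially"
      by (auto simp: filterlim_at_top_dense)
    then obtain n0 where "\<And>n. n \<ge> n0 \<Longrightarrow> R < (\<Sum>k<n. a k)"
      by (auto simp: eventually_sequentially)
    ultimately show False by (meson le_add2 not_less)
  qed
  have "AE \<omega> in M. (\<lambda>k. V k \<omega>) \<longlonglongrightarrow> 0"
  proof (rule supermartingale_tendsto_zero[where F = F and K = K])
    show "V k \<in> borel_measurable (F k)" for k
      unfolding V_def by (intro borel_measurable_add adapted) simp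
    show "integrable M (V k)" for k
      unfolding V_def using int by simp
    show "0 \<le> V k \<omega>" for k \<omega>
      by (simp add: V_def nonneg c T_nonneg)
    show "(\<integral>\<omega>. indicator B \<omega> * V (Suc k) \<omega> \<partial>M) \<le> (\<integral>\<omega>. indicator B \<omega> * V k \<omega> \<partial>M)"
      if "K \<le> k" "B \<in> sets (F k)" for k B
    proof -
      have "0 \<le> l * a k * (\<integral>\<omega>. indicator B \<omega> * e k \<omega> \<partial>M)"
        using l a_pos[of k] by (intro mult_nonneg_nonneg Bochner_Integration.integral_nonneg) (auto simp: nonneg)
      with decrease[OF that] show ?thesis by linarith
    qed
    show "\<exists>n\<ge>K. expectation (V n) < \<delta>" if \<delta>: "\<delta> > 0" for \<delta>
    proof -
      have "(\<lambda>k. c * T k) \<longlonglongrightarrow> c * 0" by (intro tendsto_intros T_lim)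
      then have "eventually (\<lambda>k. c * T k < \<delta> / 2) sequentially"
        using \<delta> by (intro order_tendstoD) auto
      then obtain N where N: "\<And>k. k \<ge> N \<Longrightarrow> c * T k < \<delta> / 2"
        by (auto simp: eventually_sequentially)
      obtain n where "n \<ge> max N K" "expectation (e n) < \<delta> / 2"
        using small_e[of "\<delta> / 2" "max N K"] \<delta> by auto
      with N[of n] show ?thesis by (intro exI[of _ n]) (simp add: E_V)
    qed
  qed (use sub F_mono in auto)
  then show ?thesis
  proof (rule AE_mp, intro AE_I2 impI)
    fix \<omega> assume "(\<lambda>k. V k \<omega>) \<longlonglongrightarrow> 0"
    then show "(\<lambda>k. e k \<omega>) \<longlonglongrightarrow> 0"
      by (rule tendsto_sandwich[OF _ _ tendsto_const, rotated 2])
        (simp_all add: V_def nonneg c T_nonneg)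
  qed
qed

section \<open>Independence of the past\<close>

text \<open>The \<open>\<sigma>\<close>-algebra generated by \<open>W 1, \<dots>, W k\<close>, as a pullback along the single map
\<open>(W 1, \<dots>, W k)\<close>. In this form, independence of disjoint blocks of the sequence becomes
independence of \<open>\<sigma>\<close>-algebras.\<close>

definition past :: "'a measure \<Rightarrow> (nat \<Rightarrow> 'a \<Rightarrow> 'b::topological_space) \<Rightarrow> nat \<Rightarrow> 'a measure" where
  "past M W k = vimage_algebra (space M) (\<lambda>\<omega>. \<lambda>i\<in>{1..k}. W i \<omega>) (\<Pi>\<^sub>M i\<in>{1..k}. borel)"

lemma space_past [simp]: "space (past M W k) = space M"
  by (simp add: past_def)

lemma measurable_past:
  assumes "i \<in> {1..k}"
  shows "W i \<in> borel_measurable (past M W k)"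
proof -
  have "(\<lambda>\<omega>. \<lambda>i\<in>{1..k}. W i \<omega>) \<in> past M W k \<rightarrow>\<^sub>M (\<Pi>\<^sub>M i\<in>{1..k}. borel)"
    unfolding past_def by (rule measurable_vimage_algebra1) (auto simp: space_PiM)
  from measurable_compose[OF this measurable_component_singleton[OF assms]]
  show ?thesis using assms by simp
qed

lemma past_least:
  assumes "space N = space M" "\<And>i. i \<in> {1..k} \<Longrightarrow> W i \<in> borel_measurable N"
  shows "sets (past M W k) \<subseteq> sets N"
  unfolding past_def
  by (rule sets_image_in_sets) (use assms in \<open>auto intro!: measurable_restrict\<close>)

lemma past_mono: "j \<le> k \<Longrightarrow> sets (past M W j) \<subseteq> sets (past M W k)"
  by (rule past_least) (auto intro!: measurable_past)

text \<open>The map \<open>g\<close> is there because \<open>indep_var\<close> relates only random variables with values in one common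
type: \<open>g\<close> brings \<open>W (Suc k)\<close> into the type of \<open>U\<close>.\<close>

lemma (in prob_space) indep_past_next:
  assumes ind: "indep_vars (\<lambda>_. borel) W {1..}" and U: "U \<in> past M W k \<rightarrow>\<^sub>M N"
    and g: "g \<in> borel \<rightarrow>\<^sub>M N'"
  shows "indep_var N U N' (\<lambda>\<omega>. g (W (Suc k) \<omega>))"
proof -
  let ?Y = "\<lambda>\<omega>. \<lambda>i\<in>{1..k}. W i \<omega>" and ?Z = "\<lambda>\<omega>. \<lambda>i\<in>{Suc k}. W i \<omega>"
  let ?next = "vimage_algebra (space M) ?Z (\<Pi>\<^sub>M i\<in>{Suc k}. borel)"
  have W: "W i \<in> borel_measurable M" if "i \<ge> 1" for i
    using ind that by (auto simp: indep_vars_def)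
  have sub: "sets (past M W k) \<subseteq> sets M"
    by (rule past_least) (auto intro: W)
  have "?Z \<in> ?next \<rightarrow>\<^sub>M (\<Pi>\<^sub>M i\<in>{Suc k}. borel)"
    by (rule measurable_vimage_algebra1) (auto simp: space_PiM)
  from measurable_compose[OF measurable_compose[OF this measurable_component_singleton[of "Suc k"]] g]
  have gW: "(\<lambda>\<omega>. g (W (Suc k) \<omega>)) \<in> ?next \<rightarrow>\<^sub>M N'" by simp
  have "indep_var (\<Pi>\<^sub>M i\<in>{1..k}. borel) ?Y (\<Pi>\<^sub>M i\<in>{Suc k}. borel) ?Z"
    by (rule indep_var_restrict[OF ind]) auto
  then have "indep_set (sets (past M W k)) (sets ?next)"
    unfolding indep_var_eq past_def sets_vimage_algebra by (rule conjunct2)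
  moreover have "sigma_sets (space M) {U -` A \<inter> space M | A. A \<in> sets N} \<subseteq> sets (past M W k)"
    using measurable_sets[OF U]
    by (intro sets.sigma_sets_subset[of _ "past M W k", unfolded space_past]) auto
  moreover have "sigma_sets (space M) {(\<lambda>\<omega>. g (W (Suc k) \<omega>)) -` A \<inter> space M | A. A \<in> sets N'} \<subseteq> sets ?next"
    using measurable_sets[OF gW]
    by (intro sets.sigma_sets_subset[of _ ?next, unfolded space_vimage_algebra]) auto
  ultimately have "indep_set (sigma_sets (space M) {U -` A \<inter> space M | A. A \<in> sets N})
      (sigma_sets (space M) {(\<lambda>\<omega>. g (W (Suc k) \<omega>)) -` A \<inter> space M | A. A \<in> sets N'})"
    unfolding indep_set_def by (elim indep_sets_mono_sets) (auto split: bool.split)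
  moreover have "random_variable N U"
    using U sub by (auto simp: measurable_def)
  ultimately show ?thesis
    unfolding indep_var_eq using measurable_compose[OF W g] by simp
qed

section \<open>Means of random matrices\<close>

lemma (in prob_space) integrable_of_norm_power2:
  fixes X :: "'a \<Rightarrow> 'b::{banach, second_countable_topology}"
  assumes "X \<in> borel_measurable M" "integrable M (\<lambda>\<omega>. (norm (X \<omega>))\<^sup>2)"
  shows "integrable M X"
proof (rule Bochner_Integration.integrable_bound)
  show "integrable M (\<lambda>\<omega>. 1 + (norm (X \<omega>))\<^sup>2)" using assms(2) by simp
  have "t \<le> 1 + t\<^sup>2" for t :: real
  proof -
    have "2 * t \<le> t\<^sup>2 + 1" using sum_squares_bound[of t 1] by simp
    with zero_le_power2[of t] show ?thesis by linarith
  qed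
  then show "AE \<omega> in M. norm (X \<omega>) \<le> norm (1 + (norm (X \<omega>))\<^sup>2)"
    by (intro AE_I2) (simp add: abs_of_nonneg)
qed fact

text \<open>The matrix is the mean of the orthogonal projections \<open>Q = HA\<close>, so its quadratic form at \<open>v\<close> is
\<open>E |Q v|\<^sup>2\<close>. If this vanishes then \<open>Q v = 0\<close> almost surely, hence \<open>W\<^sup>T A v = 0\<close> almost surely.
But \<open>E |W\<^sup>T u|\<^sup>2 = \<beta> |u|\<^sup>2\<close> for every fixed \<open>u\<close>, so \<open>A v = 0\<close>, and \<open>v = 0\<close> by the rank condition.\<close>

lemma (in prob_space) sym_pos_def_expected_projection:
  fixes A :: "real^'n^'m" and W :: "'a \<Rightarrow> real^'l^'m"
  assumes rank: "rank A = CARD('n)" and \<beta>: "\<beta> > 0"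
    and W2: "has_bochner_integral M (\<lambda>\<omega>. W \<omega> ** transpose (W \<omega>)) (\<beta> *\<^sub>R mat 1)"
    and H: "\<And>\<omega>. \<omega> \<in> space M \<Longrightarrow> H \<omega> = pinv (transpose (W \<omega>) ** A) ** transpose (W \<omega>)"
    and int_H: "integrable M H"
  shows "sym_pos_def (expectation H ** A)"
proof -
  define Q where "Q \<omega> = H \<omega> ** A" for \<omega>
  have Q: "transpose (Q \<omega>) = Q \<omega>" "Q \<omega> ** Q \<omega> = Q \<omega>"
      "transpose (W \<omega>) ** A ** Q \<omega> = transpose (W \<omega>) ** A" if "\<omega> \<in> space M" for \<omega>
    using sketched_pinv_projection[of "W \<omega>" A] H[OF that] by (simp_all add: Q_def)
  have int_Q: "integrable M Q"
    unfolding Q_def by (rule integrable_bounded_linear[OF bounded_linear_matrix_mult_right int_H])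
  have E_Q: "expectation H ** A = expectation Q"
    unfolding Q_def by (rule integral_bounded_linear[OF bounded_linear_matrix_mult_right int_H, symmetric])
  have "transpose (expectation Q) = (\<integral>\<omega>. transpose (Q \<omega>) \<partial>M)"
    by (rule integral_bounded_linear[OF bounded_linear_transpose int_Q, symmetric])
  also have "\<dots> = expectation Q" by (rule Bochner_Integration.integral_cong) (simp_all add: Q)
  finally have sym: "transpose (expectation Q) = expectation Q" .
  have proj: "v \<bullet> (Q \<omega> *v v) = (norm (Q \<omega> *v v))\<^sup>2" if "\<omega> \<in> space M" for v \<omega>
    using inner_transpose_mult[of v "Q \<omega>" "Q \<omega> *v v"] Q[OF that]
    by (simp add: power2_norm_eq_inner matrix_vector_mul_assoc del: transpose_matrix_vector)
  have "0 < v \<bullet> (expectation Q *v v)" if v: "v \<noteq> 0" for v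
  proof (rule ccontr)
    assume neg: "\<not> 0 < v \<bullet> (expectation Q *v v)"
    have int: "integrable M (\<lambda>\<omega>. v \<bullet> (Q \<omega> *v v))"
      by (rule integrable_bounded_linear[OF bounded_linear_matrix_bilinear_form int_Q])
    have eq: "v \<bullet> (expectation Q *v v) = (\<integral>\<omega>. v \<bullet> (Q \<omega> *v v) \<partial>M)"
      by (rule integral_bounded_linear[OF bounded_linear_matrix_bilinear_form int_Q, symmetric])
    have nonneg: "AE \<omega> in M. 0 \<le> v \<bullet> (Q \<omega> *v v)"
      by (intro AE_I2) (simp add: proj)
    then have "(\<integral>\<omega>. v \<bullet> (Q \<omega> *v v) \<partial>M) = 0"
      using neg eq integral_nonneg_AE[OF nonneg] by linarith
    then have "AE \<omega> in M. v \<bullet> (Q \<omega> *v v) = 0"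
      using integral_nonneg_eq_0_iff_AE[OF int nonneg] by blast
    then have AE0: "AE \<omega> in M. (A *v v) \<bullet> (W \<omega> ** transpose (W \<omega>) *v (A *v v)) = 0"
    proof (rule AE_mp, intro AE_I2 impI)
      fix \<omega> assume w: "\<omega> \<in> space M" and "v \<bullet> (Q \<omega> *v v) = 0"
      then have "Q \<omega> *v v = 0" by (simp add: proj)
      then have "transpose (W \<omega>) *v (A *v v) = 0"
        using Q(3)[OF w] by (metis matrix_vector_mul_assoc matrix_vector_mult_0_right)
      then show "(A *v v) \<bullet> (W \<omega> ** transpose (W \<omega>) *v (A *v v)) = 0"
        by (simp del: transpose_matrix_vector flip: matrix_vector_mul_assoc)
    qed
    have "has_bochner_integral M (\<lambda>\<omega>. (A *v v) \<bullet> (W \<omega> ** transpose (W \<omega>) *v (A *v v)))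
        ((A *v v) \<bullet> ((\<beta> *\<^sub>R mat 1) *v (A *v v)))"
      by (rule has_bochner_integral_bounded_linear[OF bounded_linear_matrix_bilinear_form W2])
    then have "(A *v v) \<bullet> ((\<beta> *\<^sub>R mat 1) *v (A *v v)) = 0"
      using integral_eq_zero_AE[OF AE0] by (simp add: has_bochner_integral_integral_eq)
    then have "A *v v = 0"
      using \<beta> by (simp add: scaleR_matrix_vector_assoc[symmetric])
    then show False
      using rank v unfolding full_rank_injective inj_def by (metis matrix_vector_mult_0_right)
  qed
  with sym show ?thesis by (simp add: sym_pos_def_def E_Q)
qed

lemma (in prob_space) sym_pos_semidef_expected_gram:
  fixes H :: "'a \<Rightarrow> real^'m^'n"
  assumes C: "has_bochner_integral M (\<lambda>\<omega>. transpose (H \<omega>) ** H \<omega>) C"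
  shows "sym_pos_semidef C"
  unfolding sym_pos_semidef_def
proof (intro conjI allI)
  have "has_bochner_integral M (\<lambda>\<omega>. transpose (transpose (H \<omega>) ** H \<omega>)) (transpose C)"
    by (rule has_bochner_integral_bounded_linear[OF bounded_linear_transpose C])
  then have "has_bochner_integral M (\<lambda>\<omega>. transpose (H \<omega>) ** H \<omega>) (transpose C)"
    by (simp add: matrix_transpose_mul)
  with C show "transpose C = C" by (metis has_bochner_integral_eq)
  fix v
  have "has_bochner_integral M (\<lambda>\<omega>. v \<bullet> (transpose (H \<omega>) ** H \<omega> *v v)) (v \<bullet> (C *v v))"
    by (rule has_bochner_integral_bounded_linear[OF bounded_linear_matrix_bilinear_form C])
  then have "v \<bullet> (C *v v) = (\<integral>\<omega>. v \<bullet> (transpose (H \<omega>) ** H \<omega> *v v) \<partial>M)"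
    by (rule has_bochner_integral_integral_eq[symmetric])
  also have "\<dots> \<ge> 0"
    by (intro Bochner_Integration.integral_nonneg)
      (simp add: inner_transpose_mult del: transpose_matrix_vector flip: matrix_vector_mul_assoc)
  finally show "0 \<le> v \<bullet> (C *v v)" .
qed

lemma sym_pos_semidef_congruence:
  fixes A :: "real^'n^'m"
  assumes "sym_pos_semidef C"
  shows "sym_pos_semidef (transpose A ** C ** A)"
  unfolding sym_pos_semidef_def
proof (intro conjI allI)
  show "transpose (transpose A ** C ** A) = transpose A ** C ** A"
    using assms by (simp add: sym_pos_semidef_def matrix_transpose_mul matrix_mul_assoc)
  fix v
  have "v \<bullet> (transpose A ** C ** A *v v) = (A *v v) \<bullet> (C *v (A *v v))"
    by (simp only: matrix_vector_mul_assoc[symmetric] inner_transpose_mult)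
  then show "0 \<le> v \<bullet> (transpose A ** C ** A *v v)"
    using assms by (simp add: sym_pos_semidef_def)
qed

text \<open>Averaging out a matrix that is independent of the past. Written in coordinates, the bilinear form
is a finite sum of products of a number known from the past and an entry of \<open>H\<close>, and each product
of independent integrable variables has the product of the means as its mean.\<close>

lemma (in prob_space) expectation_independent_bilinear_form:
  fixes H :: "'a \<Rightarrow> real^'m^'n" and d :: "'a \<Rightarrow> real^'n" and r :: "'a \<Rightarrow> real^'m"
  assumes sub: "subalgebra M F"
    and "d \<in> borel_measurable F" "r \<in> borel_measurable F"
    and int_d: "integrable M (\<lambda>\<omega>. (norm (d \<omega>))\<^sup>2)" and int_r: "integrable M (\<lambda>\<omega>. (norm (r \<omega>))\<^sup>2)"
    and indep: "\<And>(U :: 'a \<Rightarrow> real) g. U \<in> borel_measurable F \<Longrightarrow> g \<in> borel_measurable borel \<Longrightarrow>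
      indep_var borel U borel (\<lambda>\<omega>. g (H \<omega>))"
    and int_H: "integrable M H"
  shows "integrable M (\<lambda>\<omega>. d \<omega> \<bullet> (H \<omega> *v r \<omega>))"
    and "(\<integral>\<omega>. d \<omega> \<bullet> (H \<omega> *v r \<omega>) \<partial>M) = (\<integral>\<omega>. d \<omega> \<bullet> (expectation H *v r \<omega>) \<partial>M)"
proof -
  have sum_form: "u \<bullet> (X *v v) = (\<Sum>i\<in>UNIV. \<Sum>j\<in>UNIV. (u $ i * v $ j) * X $ i $ j)"
    for X :: "real^'m^'n" and u v
    by (simp add: inner_vec_def matrix_vector_mult_def sum_distrib_left mult_ac)
  have entry: "bounded_linear (\<lambda>X :: real^'m^'n. X $ i $ j)" for i j
    by (rule bounded_linear_compose[OF bounded_linear_vec_nth bounded_linear_vec_nth])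
  have int_Hij: "integrable M (\<lambda>\<omega>. H \<omega> $ i $ j)" for i j
    by (rule integrable_bounded_linear[OF entry int_H])
  have E_Hij: "(\<integral>\<omega>. H \<omega> $ i $ j \<partial>M) = expectation H $ i $ j" for i j
    by (rule integral_bounded_linear[OF entry int_H])
  have dr_F: "(\<lambda>\<omega>. d \<omega> $ i * r \<omega> $ j) \<in> borel_measurable F" for i j
    by (intro borel_measurable_times borel_measurable_vec_nth assms)
  have int_dr: "integrable M (\<lambda>\<omega>. d \<omega> $ i * r \<omega> $ j)" for i j
  proof (rule Bochner_Integration.integrable_bound)
    show "integrable M (\<lambda>\<omega>. (norm (d \<omega>))\<^sup>2 + (norm (r \<omega>))\<^sup>2)" using int_d int_r by simp
    show "(\<lambda>\<omega>. d \<omega> $ i * r \<omega> $ j) \<in> borel_measurable M"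
      by (rule measurable_from_subalg[OF sub dr_F])
    have "\<bar>d \<omega> $ i * r \<omega> $ j\<bar> \<le> (norm (d \<omega>))\<^sup>2 + (norm (r \<omega>))\<^sup>2" for \<omega>
    proof -
      have "\<bar>d \<omega> $ i * r \<omega> $ j\<bar> \<le> norm (d \<omega>) * norm (r \<omega>)"
        unfolding abs_mult by (intro mult_mono component_le_norm_cart) auto
      also have "\<dots> \<le> (norm (d \<omega>))\<^sup>2 + (norm (r \<omega>))\<^sup>2"
        using sum_squares_bound[of "norm (d \<omega>)" "norm (r \<omega>)"]
          mult_nonneg_nonneg[OF norm_ge_zero[of "d \<omega>"] norm_ge_zero[of "r \<omega>"]]
        by linarith
      finally show ?thesis .
    qed
    then show "AE \<omega> in M. norm (d \<omega> $ i * r \<omega> $ j) \<le> norm ((norm (d \<omega>))\<^sup>2 + (norm (r \<omega>))\<^sup>2)"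
      by (intro AE_I2) (simp add: abs_of_nonneg)
  qed
  have ind: "indep_var borel (\<lambda>\<omega>. d \<omega> $ i * r \<omega> $ j) borel (\<lambda>\<omega>. H \<omega> $ i $ j)" for i j
    by (rule indep[OF dr_F borel_measurable_continuous_onI[OF linear_continuous_on[OF entry]]])
  note int_term = indep_var_integrable[OF ind int_dr int_Hij]
  note E_term = indep_var_lebesgue_integral[OF ind int_dr int_Hij]
  show "integrable M (\<lambda>\<omega>. d \<omega> \<bullet> (H \<omega> *v r \<omega>))"
    unfolding sum_form by (intro Bochner_Integration.integrable_sum int_term)
  have "(\<integral>\<omega>. d \<omega> \<bullet> (H \<omega> *v r \<omega>) \<partial>M)
      = (\<Sum>i\<in>UNIV. \<Sum>j\<in>UNIV. \<integral>\<omega>. (d \<omega> $ i * r \<omega> $ j) * H \<omega> $ i $ j \<partial>M)"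
    unfolding sum_form
    by (simp only: Bochner_Integration.integral_sum Bochner_Integration.integrable_sum int_term)
  also have "\<dots> = (\<Sum>i\<in>UNIV. \<Sum>j\<in>UNIV. \<integral>\<omega>. (d \<omega> $ i * r \<omega> $ j) * expectation H $ i $ j \<partial>M)"
    by (simp only: E_term E_Hij integral_mult_left_zero)
  also have "\<dots> = (\<integral>\<omega>. d \<omega> \<bullet> (expectation H *v r \<omega>) \<partial>M)"
    unfolding sum_form
    by (simp only: Bochner_Integration.integral_sum Bochner_Integration.integrable_sum
        integrable_mult_left int_dr)
  finally show "(\<integral>\<omega>. d \<omega> \<bullet> (H \<omega> *v r \<omega>) \<partial>M) = (\<integral>\<omega>. d \<omega> \<bullet> (expectation H *v r \<omega>) \<partial>M)" .
qed

section \<open>One step of the iteration\<close>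

text \<open>Expand \<open>|y + a s - z|\<^sup>2 = |y - z|\<^sup>2 + 2 a (y - z) \<bullet> s + a\<^sup>2 |s|\<^sup>2\<close>. Conditionally on the past, the mean
of \<open>s\<close> is \<open>- E H (A y - b) = - E H A (y - z)\<close>, because \<open>z\<close> is a root of the mean field; so coercivity
turns the middle term into a contraction. The last term is controlled by
\<open>|s| \<le> |H| |A y - b|\<close>, where the two factors are independent and
\<open>|A y - b|\<^sup>2 \<le> (2 |A|\<^sup>2 + 2 |A z - b|\<^sup>2) (|y - z|\<^sup>2 + 1)\<close>.\<close>

lemma (in prob_space) expected_squared_distance_after_step:
  fixes A :: "real^'n^'m" and H :: "'a \<Rightarrow> real^'m^'n" and y s :: "'a \<Rightarrow> real^'n"
  assumes sub: "subalgebra M F"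
    and y_F: "y \<in> borel_measurable F"
    and int_y: "integrable M (\<lambda>\<omega>. (norm (y \<omega> - z))\<^sup>2)"
    and H_M: "H \<in> borel_measurable M"
    and indep: "\<And>(U :: 'a \<Rightarrow> real) g. U \<in> borel_measurable F \<Longrightarrow> g \<in> borel_measurable borel \<Longrightarrow>
      indep_var borel U borel (\<lambda>\<omega>. g (H \<omega>))"
    and int_H2: "integrable M (\<lambda>\<omega>. (norm (H \<omega>))\<^sup>2)"
    and root: "expectation H *v (A *v z - b) = 0"
    and coercive: "\<And>v. l * (norm v)\<^sup>2 \<le> v \<bullet> (expectation H ** A *v v)"
    and s: "\<And>\<omega>. \<omega> \<in> space M \<Longrightarrow> s \<omega> = - (H \<omega> *v (A *v y \<omega> - b))"
    and c: "c = (\<integral>\<omega>. (norm (H \<omega>))\<^sup>2 \<partial>M) * (2 * (norm A)\<^sup>2 + 2 * (norm (A *v z - b))\<^sup>2)"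
    and a: "0 \<le> a"
  shows "integrable M (\<lambda>\<omega>. (norm (s \<omega>))\<^sup>2)"
    and "integrable M (\<lambda>\<omega>. (norm (y \<omega> + a *\<^sub>R s \<omega> - z))\<^sup>2)"
    and "B \<in> sets F \<Longrightarrow> (\<integral>\<omega>. indicator B \<omega> * (norm (y \<omega> + a *\<^sub>R s \<omega> - z))\<^sup>2 \<partial>M)
      \<le> (1 - 2 * l * a + c * a\<^sup>2) * (\<integral>\<omega>. indicator B \<omega> * (norm (y \<omega> - z))\<^sup>2 \<partial>M) + c * a\<^sup>2 * prob B"
proof -
  define r where "r \<omega> = A *v y \<omega> - b" for \<omega>
  define C0 where "C0 = 2 * (norm A)\<^sup>2 + 2 * (norm (A *v z - b))\<^sup>2"
  define h2 where "h2 = (\<integral>\<omega>. (norm (H \<omega>))\<^sup>2 \<partial>M)"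
  have C0: "0 \<le> C0" by (simp add: C0_def)
  have h2: "0 \<le> h2" unfolding h2_def by (intro Bochner_Integration.integral_nonneg) simp
  have r_F: "r \<in> borel_measurable F"
    unfolding r_def
    by (intro borel_measurable_diff borel_measurable_matrix_vector_mult y_F borel_measurable_const)
  have y_M: "y \<in> borel_measurable M" and r_M: "r \<in> borel_measurable M"
    using measurable_from_subalg[OF sub] y_F r_F by auto
  have r_split: "r \<omega> = A *v (y \<omega> - z) + (A *v z - b)" for \<omega>
    by (simp add: r_def matrix_vector_mult_diff_distrib)
  have r_bound: "(norm (r \<omega>))\<^sup>2 \<le> C0 * ((norm (y \<omega> - z))\<^sup>2 + 1)" for \<omega>
  proof -
    let ?p = "norm A * norm (y \<omega> - z)" and ?q = "norm (A *v z - b)"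
    have "norm (r \<omega>) \<le> ?p + ?q"
      unfolding r_split using norm_triangle_ineq norm_matrix_vector_mult_le[of A "y \<omega> - z"]
      by (meson add_right_mono order_trans)
    then have "(norm (r \<omega>))\<^sup>2 \<le> (?p + ?q)\<^sup>2"
      by (intro power_mono) auto
    also have "\<dots> \<le> 2 * ?p\<^sup>2 + 2 * ?q\<^sup>2"
      using sum_squares_bound[of ?p ?q] by (simp add: power2_sum)
    also have "\<dots> \<le> C0 * ((norm (y \<omega> - z))\<^sup>2 + 1)"
      by (simp add: C0_def power_mult_distrib algebra_simps)
    finally show ?thesis .
  qed
  have int_r: "integrable M (\<lambda>\<omega>. (norm (r \<omega>))\<^sup>2)"
  proof (rule Bochner_Integration.integrable_bound)
    show "integrable M (\<lambda>\<omega>. C0 * ((norm (y \<omega> - z))\<^sup>2 + 1))" using int_y by simp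
    show "AE \<omega> in M. norm ((norm (r \<omega>))\<^sup>2) \<le> norm (C0 * ((norm (y \<omega> - z))\<^sup>2 + 1))"
    proof (intro AE_I2)
      fix \<omega> show "norm ((norm (r \<omega>))\<^sup>2) \<le> norm (C0 * ((norm (y \<omega> - z))\<^sup>2 + 1))"
        using r_bound[of \<omega>] by simp
    qed
  qed (use r_M in measurable)
  have int_H: "integrable M H" by (rule integrable_of_norm_power2[OF H_M int_H2])
  have s_M: "s \<in> borel_measurable M"
  proof -
    have "(\<lambda>\<omega>. - (H \<omega> *v r \<omega>)) \<in> borel_measurable M"
      by (intro borel_measurable_uminus borel_measurable_matrix_vector_mult H_M r_M)
    then show ?thesis by (rule measurable_cong[THEN iffD2, rotated]) (simp add: s r_def)
  qed
  have s_bound: "(norm (s \<omega>))\<^sup>2 \<le> (norm (r \<omega>))\<^sup>2 * (norm (H \<omega>))\<^sup>2" if "\<omega> \<in> space M" for \<omega>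
  proof -
    have "norm (s \<omega>) \<le> norm (r \<omega>) * norm (H \<omega>)"
      using norm_matrix_vector_mult_le[of "H \<omega>" "r \<omega>"] by (simp add: s[OF that] r_def mult.commute)
    then have "(norm (s \<omega>))\<^sup>2 \<le> (norm (r \<omega>) * norm (H \<omega>))\<^sup>2" by (intro power_mono) auto
    then show ?thesis by (simp add: power_mult_distrib)
  qed
  have localized: "integrable M (\<lambda>\<omega>. indicator B \<omega> * f \<omega>)"
    if "integrable M f" "B \<in> sets F" for B and f :: "'a \<Rightarrow> real"
    using integrable_mult_indicator[OF _ that(1), of B] that(2) sub by (auto simp: subalgebra_def)
  have prod_indep: "indep_var borel (\<lambda>\<omega>. indicator B \<omega> * (norm (r \<omega>))\<^sup>2) borel (\<lambda>\<omega>. (norm (H \<omega>))\<^sup>2)"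
    if B: "B \<in> sets F" for B
    by (rule indep[of _ "\<lambda>X. (norm X)\<^sup>2"]) (use r_F B in measurable)
  have int_prod: "integrable M (\<lambda>\<omega>. (indicator B \<omega> * (norm (r \<omega>))\<^sup>2) * (norm (H \<omega>))\<^sup>2)"
    and E_prod: "(\<integral>\<omega>. (indicator B \<omega> * (norm (r \<omega>))\<^sup>2) * (norm (H \<omega>))\<^sup>2 \<partial>M)
      = (\<integral>\<omega>. indicator B \<omega> * (norm (r \<omega>))\<^sup>2 \<partial>M) * h2"
    if B: "B \<in> sets F" for B
    unfolding h2_def
    by (rule indep_var_integrable indep_var_lebesgue_integral; rule prod_indep[OF B] localized[OF int_r B] int_H2)+
  have top: "space M \<in> sets F"
    using sub sets.top[of F] by (simp add: subalgebra_def)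
  have "integrable M (\<lambda>\<omega>. (norm (r \<omega>))\<^sup>2 * (norm (H \<omega>))\<^sup>2)"
    using int_prod[OF top] by (simp cong: Bochner_Integration.integrable_cong)
  then show int_s: "integrable M (\<lambda>\<omega>. (norm (s \<omega>))\<^sup>2)"
    by (rule Bochner_Integration.integrable_bound)
      (use s_M s_bound in \<open>auto intro!: AE_I2\<close>)
  have d_F: "(\<lambda>\<omega>. y \<omega> - z) \<in> borel_measurable F"
    by (intro borel_measurable_diff y_F borel_measurable_const)
  have d_eq: "(y \<omega> - z) \<bullet> s \<omega> = - ((y \<omega> - z) \<bullet> (H \<omega> *v r \<omega>))" if "\<omega> \<in> space M" for \<omega>
    by (simp add: s[OF that] r_def)
  have "integrable M (\<lambda>\<omega>. - ((y \<omega> - z) \<bullet> (H \<omega> *v r \<omega>)))"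
    by (intro Bochner_Integration.integrable_minus
        expectation_independent_bilinear_form(1)[OF sub d_F r_F int_y int_r indep int_H])
  then have int_ds: "integrable M (\<lambda>\<omega>. (y \<omega> - z) \<bullet> s \<omega>)"
    by (simp only: d_eq cong: Bochner_Integration.integrable_cong)
  have expand: "(norm (y \<omega> + a *\<^sub>R s \<omega> - z))\<^sup>2
      = (norm (y \<omega> - z))\<^sup>2 + 2 * a * ((y \<omega> - z) \<bullet> s \<omega>) + a\<^sup>2 * (norm (s \<omega>))\<^sup>2" for \<omega>
    unfolding power2_norm_eq_inner
    by (simp add: inner_simps inner_commute algebra_simps power2_eq_square)
  show "integrable M (\<lambda>\<omega>. (norm (y \<omega> + a *\<^sub>R s \<omega> - z))\<^sup>2)"
    unfolding expand using int_y int_ds int_s by simp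
  assume B: "B \<in> sets F"
  then have BM: "B \<in> sets M" using sub by (auto simp: subalgebra_def)
  let ?E = "\<integral>\<omega>. indicator B \<omega> * (norm (y \<omega> - z))\<^sup>2 \<partial>M"
  have drift: "(\<integral>\<omega>. indicator B \<omega> * ((y \<omega> - z) \<bullet> s \<omega>) \<partial>M) \<le> - l * ?E"
  proof -
    let ?d = "\<lambda>\<omega>. indicator B \<omega> *\<^sub>R (y \<omega> - z)"
    have dB_F: "?d \<in> borel_measurable F"
      using B d_F by measurable
    have int_dB: "integrable M (\<lambda>\<omega>. (norm (?d \<omega>))\<^sup>2)"
      using localized[OF int_y B] by (rule back_subst[of "integrable M"]) (auto simp: indicator_def)
    have "l * ?E = (\<integral>\<omega>. indicator B \<omega> * (l * (norm (y \<omega> - z))\<^sup>2) \<partial>M)"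
      by (simp add: mult.left_commute)
    also have "\<dots> \<le> (\<integral>\<omega>. ?d \<omega> \<bullet> (expectation H *v r \<omega>) \<partial>M)"
    proof (rule integral_mono)
      have Hr: "expectation H *v r \<omega> = expectation H ** A *v (y \<omega> - z)" for \<omega>
        by (simp add: r_split matrix_vector_right_distrib root matrix_vector_mul_assoc)
      show "indicator B \<omega> * (l * (norm (y \<omega> - z))\<^sup>2) \<le> ?d \<omega> \<bullet> (expectation H *v r \<omega>)" for \<omega>
        unfolding Hr using coercive[of "y \<omega> - z"] by (auto simp: indicator_def)
      show "integrable M (\<lambda>\<omega>. indicator B \<omega> * (l * (norm (y \<omega> - z))\<^sup>2))"
        using int_y B by (intro localized) auto
      \<comment> \<open>A constant is independent of everything, so integrability follows from the same lemma as for \<open>H\<close>.\<close>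
      have const: "indep_var borel U borel (\<lambda>\<omega>. g (expectation H))"
        if "U \<in> borel_measurable F" for U :: "'a \<Rightarrow> real" and g :: "real^'m^'n \<Rightarrow> real"
        using indep[OF that, of "\<lambda>_. g (expectation H)"] by simp
      show "integrable M (\<lambda>\<omega>. ?d \<omega> \<bullet> (expectation H *v r \<omega>))"
        by (rule expectation_independent_bilinear_form(1)[OF sub dB_F r_F int_dB int_r, where H = "\<lambda>_. expectation H"])
          (auto intro: const)
    qed
    also have "\<dots> = (\<integral>\<omega>. ?d \<omega> \<bullet> (H \<omega> *v r \<omega>) \<partial>M)"
      by (rule expectation_independent_bilinear_form(2)[OF sub dB_F r_F int_dB int_r indep int_H, symmetric])
    also have "\<dots> = (\<integral>\<omega>. - (indicator B \<omega> * ((y \<omega> - z) \<bullet> s \<omega>)) \<partial>M)"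
      by (rule Bochner_Integration.integral_cong) (simp_all add: d_eq)
    finally show ?thesis by simp
  qed
  have noise: "(\<integral>\<omega>. indicator B \<omega> * (norm (s \<omega>))\<^sup>2 \<partial>M) \<le> c * (?E + prob B)"
  proof -
    have "(\<integral>\<omega>. indicator B \<omega> * (norm (s \<omega>))\<^sup>2 \<partial>M)
        \<le> (\<integral>\<omega>. (indicator B \<omega> * (norm (r \<omega>))\<^sup>2) * (norm (H \<omega>))\<^sup>2 \<partial>M)"
      using s_bound by (intro integral_mono localized[OF int_s B] int_prod[OF B]) (auto simp: indicator_def)
    also have "\<dots> \<le> (C0 * (?E + prob B)) * h2"
    proof (subst E_prod[OF B], intro mult_right_mono h2)
      have "integrable M (\<lambda>\<omega>. indicator B \<omega> * (C0 * ((norm (y \<omega> - z))\<^sup>2 + 1)))"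
        using int_y B by (intro localized) auto
      then have "(\<integral>\<omega>. indicator B \<omega> * (norm (r \<omega>))\<^sup>2 \<partial>M)
          \<le> (\<integral>\<omega>. indicator B \<omega> * (C0 * ((norm (y \<omega> - z))\<^sup>2 + 1)) \<partial>M)"
        using r_bound by (intro integral_mono localized[OF int_r B]) (auto simp: indicator_def)
      also have "\<dots> = (\<integral>\<omega>. C0 * (indicator B \<omega> * (norm (y \<omega> - z))\<^sup>2 + indicator B \<omega>) \<partial>M)"
        by (simp add: algebra_simps)
      also have "\<dots> = C0 * (?E + prob B)"
        using localized[OF int_y B] BM by (simp add: less_top[symmetric])
      finally show "(\<integral>\<omega>. indicator B \<omega> * (norm (r \<omega>))\<^sup>2 \<partial>M) \<le> C0 * (?E + prob B)" .
    qed
    finally show ?thesis by (simp add: c C0_def h2_def mult_ac)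
  qed
  have "(\<integral>\<omega>. indicator B \<omega> * (norm (y \<omega> + a *\<^sub>R s \<omega> - z))\<^sup>2 \<partial>M)
      = (\<integral>\<omega>. indicator B \<omega> * (norm (y \<omega> - z))\<^sup>2 + 2 * a * (indicator B \<omega> * ((y \<omega> - z) \<bullet> s \<omega>))
          + a\<^sup>2 * (indicator B \<omega> * (norm (s \<omega>))\<^sup>2) \<partial>M)"
    unfolding expand by (simp add: algebra_simps)
  also have "\<dots> = ?E + 2 * a * (\<integral>\<omega>. indicator B \<omega> * ((y \<omega> - z) \<bullet> s \<omega>) \<partial>M)
      + a\<^sup>2 * (\<integral>\<omega>. indicator B \<omega> * (norm (s \<omega>))\<^sup>2 \<partial>M)"
    using localized[OF int_y B] localized[OF int_ds B] localized[OF int_s B] by simp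
  also have "\<dots> \<le> ?E + 2 * a * (- l * ?E) + a\<^sup>2 * (c * (?E + prob B))"
    using drift noise a by (intro add_mono mult_left_mono) auto
  finally show "(\<integral>\<omega>. indicator B \<omega> * (norm (y \<omega> + a *\<^sub>R s \<omega> - z))\<^sup>2 \<partial>M)
      \<le> (1 - 2 * l * a + c * a\<^sup>2) * ?E + c * a\<^sup>2 * prob B"
    by (simp add: algebra_simps)
qed

section \<open>Almost sure convergence\<close>

theorem theorem3p3:
  fixes M :: "'w measure"
    and A :: "real^'n^'m" and b :: "real^'m"
    and \<beta> :: real
    and W :: "nat \<Rightarrow> 'w \<Rightarrow> real^'l^'m"
    and H :: "nat \<Rightarrow> 'w \<Rightarrow> real^'m^'n"
    and C :: "real^'m^'m" and P :: "real^'m^'n"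
    and \<alpha> :: "nat \<Rightarrow> real"
    and x0 xt :: "real^'n"
    and x s :: "nat \<Rightarrow> 'w \<Rightarrow> real^'n"
  assumes "prob_space M"
    and "rank A = CARD('n)"
    and "\<beta> > 0"
    and W_indep: "prob_space.indep_vars M (\<lambda>_. borel) W {1..}"
    and W_ident: "\<And>k. k \<ge> 1 \<Longrightarrow> distr M borel (W k) = distr M borel (W 1)"
    and W_second_moment: "\<And>k. k \<ge> 1 \<Longrightarrow>
          has_bochner_integral M (\<lambda>\<omega>. W k \<omega> ** transpose (W k \<omega>)) (\<beta> *\<^sub>R mat 1)"
    and H_eq: "\<And>k \<omega>. k \<ge> 1 \<Longrightarrow> \<omega> \<in> space M \<Longrightarrow>
          H k \<omega> = pinv (transpose (W k \<omega>) ** A) ** transpose (W k \<omega>)"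
    and C_eq: "has_bochner_integral M (\<lambda>\<omega>. transpose (H 1 \<omega>) ** H 1 \<omega>) C"
    and \<alpha>_pos: "\<And>k. k \<ge> 1 \<Longrightarrow> \<alpha> k > 0"
    and \<alpha>_sum: "filterlim (\<lambda>N. \<Sum>k=1..N. \<alpha> k) at_top sequentially"
    and \<alpha>_sq_sum: "summable (\<lambda>k. (\<alpha> (Suc k))\<^sup>2)"
    and P_eq: "P = (\<integral>\<omega>. H 1 \<omega> \<partial>M)"
    and xt_eq: "xt = matrix_inv (P ** A) *v (P *v b)"
    and x_0: "\<And>\<omega>. \<omega> \<in> space M \<Longrightarrow> x 0 \<omega> = x0"
    and x_rec: "\<And>k \<omega>. k \<ge> 1 \<Longrightarrow> \<omega> \<in> space M \<Longrightarrow>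
          x k \<omega> = x (k - 1) \<omega> + \<alpha> k *\<^sub>R s k \<omega>"
    and s_eq: "\<And>k \<omega>. k \<ge> 1 \<Longrightarrow> \<omega> \<in> space M \<Longrightarrow>
          s k \<omega> = - (H k \<omega> *v (A *v x (k - 1) \<omega> - b))"
  shows "(sym_pos_semidef C \<and> sym_pos_semidef (transpose A ** C ** A)
            \<and> integrable M (H 1) \<and> sym_pos_def (P ** A) \<and> invertible (P ** A))
       \<and> ((\<forall>k. integrable M (\<lambda>\<omega>. (norm (x k \<omega> - xt))\<^sup>2))
            \<and> (\<forall>k\<ge>1. integrable M (\<lambda>\<omega>. (norm (s k \<omega>))\<^sup>2)))
       \<and> (AE \<omega> in M. (\<lambda>k. x k \<omega>) \<longlonglongrightarrow> xt)"
proof -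
  interpret prob_space M by fact
  define h where "h X = pinv (transpose X ** A) ** transpose X" for X :: "real^'l^'m"
  have h_meas [measurable]: "h \<in> borel_measurable borel"
    unfolding h_def by (rule borel_measurable_sketched_pinv)
  have H_h: "H k \<omega> = h (W k \<omega>)" if "k \<ge> 1" "\<omega> \<in> space M" for k \<omega>
    using H_eq[OF that] by (simp add: h_def)
  have W_meas [measurable]: "W k \<in> borel_measurable M" if "k \<ge> 1" for k
    using W_indep that by (auto simp: indep_vars_def)
  have W1 [measurable]: "W 1 \<in> borel_measurable M" by (rule W_meas) simp

  have H1_meas: "H 1 \<in> borel_measurable M"
    by (rule measurable_cong[THEN iffD2, OF H_h measurable_compose[OF W1 h_meas]]) simp_all
  have "integrable M (\<lambda>\<omega>. trace (transpose (H 1 \<omega>) ** H 1 \<omega>))"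
    by (rule integrable_bounded_linear[OF bounded_linear_trace has_bochner_integral_iff[THEN iffD1, OF C_eq, THEN conjunct1]])
  then have int_H1_2: "integrable M (\<lambda>\<omega>. (norm (H 1 \<omega>))\<^sup>2)"
    by (simp only: norm_matrix_power2_eq_trace)
  have int_H1: "integrable M (H 1)"
    by (rule integrable_of_norm_power2[OF H1_meas int_H1_2])

  have C: "sym_pos_semidef C"
    by (rule sym_pos_semidef_expected_gram[OF C_eq])
  have PA: "sym_pos_def (P ** A)"
    unfolding P_eq
    by (rule sym_pos_def_expected_projection[OF assms(2,3) W_second_moment[of 1] H_eq int_H1]) simp_all
  have inv: "invertible (P ** A)"
    by (rule sym_pos_def_imp_invertible[OF PA])
  \<comment> \<open>\<open>xt\<close> is the root of the mean field, because \<open>PA\<close> is invertible.\<close>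
  have root: "P *v (A *v xt - b) = 0"
  proof -
    have "P *v (A *v xt) = (P ** A ** matrix_inv (P ** A)) *v (P *v b)"
      by (simp add: xt_eq matrix_vector_mul_assoc matrix_mul_assoc)
    moreover have "P ** A ** matrix_inv (P ** A) = mat 1"
      using inv unfolding invertible_def matrix_inv_def by (rule someI2_ex) blast
    ultimately show ?thesis
      by (simp add: matrix_vector_mult_diff_distrib)
  qed
  obtain l where l: "l > 0" and coercive: "\<And>v. l * (norm v)\<^sup>2 \<le> v \<bullet> (P ** A *v v)"
    using sym_pos_def_coercive[OF PA] by blast

  \<comment> \<open>Since \<open>h\<close> is a fixed Borel function, the \<open>H k\<close> are identically distributed with \<open>H 1\<close>.\<close>
  have transfer_integral: "(\<integral>\<omega>. g (h (W k \<omega>)) \<partial>M) = (\<integral>\<omega>. g (H 1 \<omega>) \<partial>M)"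
    and transfer_integrable: "integrable M (\<lambda>\<omega>. g (H 1 \<omega>)) \<Longrightarrow> integrable M (\<lambda>\<omega>. g (h (W k \<omega>)))"
    if k: "k \<ge> 1" and g [measurable]: "g \<in> borel_measurable borel"
    for k and g :: "real^'m^'n \<Rightarrow> 'e::{banach, second_countable_topology}"
  proof -
    have gh: "(\<lambda>X. g (h X)) \<in> borel_measurable borel" by measurable
    have "(\<integral>\<omega>. g (h (W k \<omega>)) \<partial>M) = (\<integral>\<omega>. g (h (W 1 \<omega>)) \<partial>M)"
      using integral_distr[OF W_meas[OF k] gh] integral_distr[OF W1 gh] W_ident[OF k] by simp
    also have "\<dots> = (\<integral>\<omega>. g (H 1 \<omega>) \<partial>M)"
      by (rule Bochner_Integration.integral_cong) (simp_all add: H_h)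
    finally show "(\<integral>\<omega>. g (h (W k \<omega>)) \<partial>M) = (\<integral>\<omega>. g (H 1 \<omega>) \<partial>M)" .
    assume "integrable M (\<lambda>\<omega>. g (H 1 \<omega>))"
    then have "integrable M (\<lambda>\<omega>. g (h (W 1 \<omega>)))"
      by (rule Bochner_Integration.integrable_cong[THEN iffD1, rotated 2]) (simp_all add: H_h)
    then show "integrable M (\<lambda>\<omega>. g (h (W k \<omega>)))"
      using integrable_distr_eq[OF W_meas[OF k] gh] integrable_distr_eq[OF W1 gh] W_ident[OF k] by simp
  qed

  let ?F = "past M W"
  have sub: "subalgebra M (?F k)" for k
    unfolding subalgebra_def by (intro conjI space_past past_least refl W_meas) simp
  have x_Suc: "x (Suc k) \<omega> = x k \<omega> + \<alpha> (Suc k) *\<^sub>R s (Suc k) \<omega>" if "\<omega> \<in> space M" for k \<omega>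
    using x_rec[of "Suc k"] that by simp
  have s_Suc: "s (Suc k) \<omega> = - (h (W (Suc k) \<omega>) *v (A *v x k \<omega> - b))" if "\<omega> \<in> space M" for k \<omega>
    using s_eq[of "Suc k"] H_h[of "Suc k"] that by simp
  have x_F: "x k \<in> borel_measurable (?F k)" for k
  proof (induction k)
    case 0
    show ?case
      by (rule measurable_cong[THEN iffD2, of _ _ "\<lambda>_. x0"]) (simp_all add: x_0)
  next
    case (Suc k)
    have x': "x k \<in> borel_measurable (?F (Suc k))"
      using Suc past_mono[of k "Suc k" M W] by (auto simp: measurable_def)
    have h': "(\<lambda>\<omega>. h (W (Suc k) \<omega>)) \<in> borel_measurable (?F (Suc k))"
      by (rule measurable_compose[OF measurable_past h_meas]) simp
    have "(\<lambda>\<omega>. x k \<omega> + \<alpha> (Suc k) *\<^sub>R - (h (W (Suc k) \<omega>) *v (A *v x k \<omega> - b))) \<in> borel_measurable (?F (Suc k))"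
      by (intro borel_measurable_add borel_measurable_scaleR borel_measurable_uminus borel_measurable_diff
          borel_measurable_matrix_vector_mult borel_measurable_const x' h')
    then show ?case
      by (rule measurable_cong[THEN iffD2, rotated]) (simp add: x_Suc s_Suc)
  qed

  define c where "c = (\<integral>\<omega>. (norm (H 1 \<omega>))\<^sup>2 \<partial>M) * (2 * (norm A)\<^sup>2 + 2 * (norm (A *v xt - b))\<^sup>2)"
  have c: "c \<ge> 0"
    unfolding c_def by (intro mult_nonneg_nonneg Bochner_Integration.integral_nonneg) simp_all
  have E_h: "(\<integral>\<omega>. h (W (Suc k) \<omega>) \<partial>M) = P" for k
    using transfer_integral[of "Suc k" "\<lambda>X. X"] by (simp add: P_eq)
  have E_h2: "(\<integral>\<omega>. (norm (h (W (Suc k) \<omega>)))\<^sup>2 \<partial>M) = (\<integral>\<omega>. (norm (H 1 \<omega>))\<^sup>2 \<partial>M)" for k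
    by (rule transfer_integral[of "Suc k" "\<lambda>X. (norm X)\<^sup>2"]) simp_all
  have int_h2: "integrable M (\<lambda>\<omega>. (norm (h (W (Suc k) \<omega>)))\<^sup>2)" for k
    by (rule transfer_integrable[of "Suc k" "\<lambda>X. (norm X)\<^sup>2", OF _ _ int_H1_2]) simp_all
  have h_M: "(\<lambda>\<omega>. h (W (Suc k) \<omega>)) \<in> borel_measurable M" for k
    by (rule measurable_compose[OF W_meas h_meas]) simp
  have h_indep: "indep_var borel U borel (\<lambda>\<omega>. g (h (W (Suc k) \<omega>)))"
    if "U \<in> borel_measurable (?F k)" "g \<in> borel_measurable borel"
    for k and U :: "'w \<Rightarrow> real" and g :: "real^'m^'n \<Rightarrow> real"
    by (rule indep_past_next[OF W_indep that(1) measurable_compose[OF h_meas that(2)]])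
  have root': "(\<integral>\<omega>. h (W (Suc k) \<omega>) \<partial>M) *v (A *v xt - b) = 0" for k
    by (simp only: E_h root)
  have coercive': "l * (norm v)\<^sup>2 \<le> v \<bullet> ((\<integral>\<omega>. h (W (Suc k) \<omega>) \<partial>M) ** A *v v)" for v k
    by (simp only: E_h coercive)
  have c_eq: "c = (\<integral>\<omega>. (norm (h (W (Suc k) \<omega>)))\<^sup>2 \<partial>M) * (2 * (norm A)\<^sup>2 + 2 * (norm (A *v xt - b))\<^sup>2)" for k
    by (simp only: c_def E_h2)
  have \<alpha>_nonneg: "0 \<le> \<alpha> (Suc k)" for k
    using \<alpha>_pos[of "Suc k"] by simp
  \<comment> \<open>The \<open>k\<close>-th iterate is a function of the first \<open>k\<close> sketches, so the step to the next iterate uses a fresh independent one.\<close>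
  have step:
      "integrable M (\<lambda>\<omega>. (norm (s (Suc k) \<omega>))\<^sup>2)"
      "integrable M (\<lambda>\<omega>. (norm (x k \<omega> + \<alpha> (Suc k) *\<^sub>R s (Suc k) \<omega> - xt))\<^sup>2)"
      "B \<in> sets (?F k) \<Longrightarrow>
        (\<integral>\<omega>. indicator B \<omega> * (norm (x k \<omega> + \<alpha> (Suc k) *\<^sub>R s (Suc k) \<omega> - xt))\<^sup>2 \<partial>M)
          \<le> (1 - 2 * l * \<alpha> (Suc k) + c * (\<alpha> (Suc k))\<^sup>2) * (\<integral>\<omega>. indicator B \<omega> * (norm (x k \<omega> - xt))\<^sup>2 \<partial>M)
            + c * (\<alpha> (Suc k))\<^sup>2 * prob B"
    if int: "integrable M (\<lambda>\<omega>. (norm (x k \<omega> - xt))\<^sup>2)" for k B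
  proof -
    note one_step = expected_squared_distance_after_step[OF sub x_F int h_M h_indep int_h2
        root' coercive' s_Suc c_eq \<alpha>_nonneg[of k]]
    show "integrable M (\<lambda>\<omega>. (norm (s (Suc k) \<omega>))\<^sup>2)"
      by (rule one_step(1); assumption)
    show "integrable M (\<lambda>\<omega>. (norm (x k \<omega> + \<alpha> (Suc k) *\<^sub>R s (Suc k) \<omega> - xt))\<^sup>2)"
      by (rule one_step(2); assumption)
    show "(\<integral>\<omega>. indicator B \<omega> * (norm (x k \<omega> + \<alpha> (Suc k) *\<^sub>R s (Suc k) \<omega> - xt))\<^sup>2 \<partial>M)
          \<le> (1 - 2 * l * \<alpha> (Suc k) + c * (\<alpha> (Suc k))\<^sup>2) * (\<integral>\<omega>. indicator B \<omega> * (norm (x k \<omega> - xt))\<^sup>2 \<partial>M)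
            + c * (\<alpha> (Suc k))\<^sup>2 * prob B" if "B \<in> sets (?F k)"
      by (rule one_step(3)[OF _ _ _ that]; assumption)
  qed
  have int_e: "integrable M (\<lambda>\<omega>. (norm (x k \<omega> - xt))\<^sup>2)" for k
  proof (induction k)
    case 0
    have "integrable M (\<lambda>\<omega>. (norm (x0 - xt))\<^sup>2)" by simp
    then show ?case
      by (rule Bochner_Integration.integrable_cong[THEN iffD1, rotated 2]) (simp_all add: x_0)
  next
    case (Suc k)
    from step(2)[OF Suc] show ?case
      by (rule Bochner_Integration.integrable_cong[THEN iffD1, rotated 2]) (simp_all add: x_Suc)
  qed
  have int_s: "integrable M (\<lambda>\<omega>. (norm (s k \<omega>))\<^sup>2)" if k: "k \<ge> 1" for k
  proof -
    obtain j where "k = Suc j" using k by (cases k) simp_all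
    then show ?thesis using step(1)[OF int_e, of j] by (simp only:)
  qed

  have "AE \<omega> in M. (\<lambda>k. (norm (x k \<omega> - xt))\<^sup>2) \<longlonglongrightarrow> 0"
  proof (rule perturbed_contraction_tendsto_zero[where F = ?F and l = l and c = c and a = "\<lambda>k. \<alpha> (Suc k)"])
    show "(\<lambda>\<omega>. (norm (x k \<omega> - xt))\<^sup>2) \<in> borel_measurable (?F k)" for k
      by (intro borel_measurable_power measurable_compose[OF _ borel_measurable_norm] borel_measurable_diff x_F
          borel_measurable_const)
    show "filterlim (\<lambda>N. \<Sum>k<N. \<alpha> (Suc k)) at_top sequentially"
      using \<alpha>_sum by (simp add: sum.atLeast1_atMost_eq)
    show "(\<integral>\<omega>. indicator B \<omega> * (norm (x (Suc k) \<omega> - xt))\<^sup>2 \<partial>M)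
        \<le> (1 - 2 * l * \<alpha> (Suc k) + c * (\<alpha> (Suc k))\<^sup>2) * (\<integral>\<omega>. indicator B \<omega> * (norm (x k \<omega> - xt))\<^sup>2 \<partial>M)
          + c * (\<alpha> (Suc k))\<^sup>2 * prob B"
      if "B \<in> sets (?F k)" for k B
    proof -
      have "(\<integral>\<omega>. indicator B \<omega> * (norm (x (Suc k) \<omega> - xt))\<^sup>2 \<partial>M)
          = (\<integral>\<omega>. indicator B \<omega> * (norm (x k \<omega> + \<alpha> (Suc k) *\<^sub>R s (Suc k) \<omega> - xt))\<^sup>2 \<partial>M)"
        by (rule Bochner_Integration.integral_cong) (simp_all add: x_Suc)
      also note step(3)[OF int_e that]
      finally show ?thesis .
    qed
  qed (use sub int_e l c \<alpha>_pos \<alpha>_sq_sum in \<open>simp_all add: past_mono\<close>)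
  then have "AE \<omega> in M. (\<lambda>k. x k \<omega>) \<longlonglongrightarrow> xt"
  proof (rule AE_mp, intro AE_I2 impI)
    fix \<omega> assume "(\<lambda>k. (norm (x k \<omega> - xt))\<^sup>2) \<longlonglongrightarrow> 0"
    then have "(\<lambda>k. sqrt ((norm (x k \<omega> - xt))\<^sup>2)) \<longlonglongrightarrow> sqrt 0"
      by (rule tendsto_real_sqrt)
    then show "(\<lambda>k. x k \<omega>) \<longlonglongrightarrow> xt"
      by (simp add: LIM_zero_iff tendsto_norm_zero_iff)
  qed
  then show ?thesis
    using C sym_pos_semidef_congruence[OF C, of A] int_H1 PA inv int_e int_s by blast
qed

end
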